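(* Let $n\geq 3$ and let $\Bbbk$ be a field. (1) If $n$ is odd, then the cluster variety $V(\mathcal{A}(\Delta_n),\Bbbk)$ has no deep points. (2) If $n$ is even, then a choice of values on the edges of $\Delta_n$, $p:\{\text{edges in }\Delta_n\}\to\Bbbk^\times$, extends to a deep point of $V(\mathcal{A}(\Delta_n),\Bbbk)$ if and only if $$\frac{p(x_{1,2})\,p(x_{3,4})\cdots p(x_{n-1,n})}{p(x_{1,n})\,p(x_{2,3})\cdots p(x_{n-2,n-1})}=(-1)^{\frac{n+2}{2}},$$ and this extension is unique, with values on an arbitrary diagonal $x_{i,j}$ ($i<j$) given by $$p(x_{i,j})=\begin{cases}(-1)^{\frac{j-i-1}{2}}\,\dfrac{p(x_{i,i+1})\,p(x_{i+2,i+3})\cdots p(x_{j-1,j})}{p(x_{i+1,i+2})\cdots p(x_{j-2,j-1})} & \text{if } i\not\equiv j \bmod 2,\\[2mm] 0 & \text{if } i\equiv j\bmod 2.\end{cases}$$ As a consequence, the deep locus of $V(\mathcal{A}(\Delta_n),\Bbbk)$ is freely determined by its values on all but one edge, and is therefore isomorphic to $(\Bbbk^\times)^{n-1}$.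
   Context: $\Delta_n$ is a convex $n$-gon with vertices indexed clockwise $1,\dots,n$. Define $$P_{2,n}=\mathbb{Z}[x_{i,j}:1\le i<j\le n]\big/\big\langle x_{i,k}x_{j,l}-(x_{i,j}x_{k,l}+x_{i,l}x_{j,k}):1\le i<j<k<l\le n\big\rangle .$$ The generator $x_{i,j}$ is identified with the segment joining vertices $i$ and $j$; it is an edge if $j=i+1$ or $(i,j)=(1,n)$, and a diagonal otherwise. The cluster algebra of the $n$-gon with boundary coefficients is the localization $\mathcal{A}(\Delta_n)=P_{2,n}[x_{i,j}^{-1}:x_{i,j}\text{ an edge}]$. It is a cluster algebra of type $A_{n-3}$ whose mutable cluster variables are the diagonals, whose frozen variables are the edges, and whose clusters are the triangulations of $\Delta_n$ (each including all the edges). $V(\mathcal{A}(\Delta_n),\Bbbk)=\mathrm{Hom}_{\mathrm{Ring}}(\mathcal{A}(\Delta_n),\Bbbk)$ with the Zariski topology; a point is the same as a map from the diagonals and edges to $\Bbbk$ which satisfies the relations of $P_{2,n}$ and does not send any edge to $0$. A point $p$ is deep if every triangulation of $\Delta_n$ contains a diagonal $x_{i,j}$ with $p(x_{i,j})=0$. The deep locus is the set of deep points, a Zariski closed subset. *)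

theory Defs
  imports
    "HOL-Library.FuncSet"
    "HOL-Library.Poly_Mapping"
    "HOL-Algebra.QuotRing"
    "HOL-Algebra.Algebraic_Closure_Type"
begin

section \<open>Combinatorics of the \<open>n\<close>-gon\<close>

text \<open>
  The segment joining the vertices \<open>i < j\<close> is represented by the pair \<open>(i, j)\<close>.
\<close>

definition segments :: "nat \<Rightarrow> (nat \<times> nat) set" where
  "segments n = {(i, j). 1 \<le> i \<and> i < j \<and> j \<le> n}"

definition edges :: "nat \<Rightarrow> (nat \<times> nat) set" where
  "edges n = {(i, j) \<in> segments n. j = i + 1 \<or> (i = 1 \<and> j = n)}"

definition diagonals :: "nat \<Rightarrow> (nat \<times> nat) set" where
  "diagonals n = segments n - edges n"

text \<open>
  As the polygon is convex and its vertices are numbered cyclically, two segments meet in their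
  interiors exactly when their endpoints interlace.
\<close>

definition crossing :: "nat \<times> nat \<Rightarrow> nat \<times> nat \<Rightarrow> bool" where
  "crossing s t \<longleftrightarrow>
     (fst s < fst t \<and> fst t < snd s \<and> snd s < snd t) \<or>
     (fst t < fst s \<and> fst s < snd t \<and> snd t < snd s)"

definition noncrossing :: "(nat \<times> nat) set \<Rightarrow> bool" where
  "noncrossing T \<longleftrightarrow> (\<forall>s\<in>T. \<forall>t\<in>T. \<not> crossing s t)"

text \<open>
  A triangulation is a maximal set of pairwise noncrossing segments.  Edges cross no
  segment, so by maximality a triangulation contains all of them.
\<close>

definition triangulation :: "nat \<Rightarrow> (nat \<times> nat) set \<Rightarrow> bool" where
  "triangulation n T \<longleftrightarrow>
     T \<subseteq> segments n \<and> noncrossing T \<and>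
     (\<forall>T'. T \<subseteq> T' \<and> T' \<subseteq> segments n \<and> noncrossing T' \<longrightarrow> T' = T)"


section \<open>Localization of a commutative ring\<close>

text \<open>The multiplicative submonoid generated by \<open>E\<close>.\<close>

inductive_set mult_closure :: "('a, 'm) ring_scheme \<Rightarrow> 'a set \<Rightarrow> 'a set"
  for R (structure) and E where
  one: "\<one> \<in> mult_closure R E"
| mult: "\<lbrakk>s \<in> mult_closure R E; e \<in> E\<rbrakk> \<Longrightarrow> s \<otimes> e \<in> mult_closure R E"

text \<open>The pair \<open>(a, s)\<close> stands for the fraction \<open>a/s\<close>.\<close>

definition frac_rel ::
  "('a, 'm) ring_scheme \<Rightarrow> 'a set \<Rightarrow> (('a \<times> 'a) \<times> ('a \<times> 'a)) set" where
  "frac_rel R S = {((a, s), (b, t)).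
     a \<in> carrier R \<and> s \<in> S \<and> b \<in> carrier R \<and> t \<in> S \<and>
     (\<exists>u\<in>S. u \<otimes>\<^bsub>R\<^esub> (a \<otimes>\<^bsub>R\<^esub> t) = u \<otimes>\<^bsub>R\<^esub> (b \<otimes>\<^bsub>R\<^esub> s))}"

definition loc_frac :: "('a, 'm) ring_scheme \<Rightarrow> 'a set \<Rightarrow> 'a \<Rightarrow> 'a \<Rightarrow> ('a \<times> 'a) set" where
  "loc_frac R S a s = frac_rel R S `` {(a, s)}"

text \<open>
  The unions in the operations range over all choices of representatives; each of them is a
  union of copies of one and the same class.
\<close>

definition localization :: "('a, 'm) ring_scheme \<Rightarrow> 'a set \<Rightarrow> ('a \<times> 'a) set ring" where
  "localization R S = \<lparr>
     carrier = (carrier R \<times> S) // frac_rel R S,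
     monoid.mult = (\<lambda>U V. \<Union>(a, s)\<in>U. \<Union>(b, t)\<in>V. loc_frac R S (a \<otimes>\<^bsub>R\<^esub> b) (s \<otimes>\<^bsub>R\<^esub> t)),
     one = loc_frac R S \<one>\<^bsub>R\<^esub> \<one>\<^bsub>R\<^esub>,
     ring.zero = loc_frac R S \<zero>\<^bsub>R\<^esub> \<one>\<^bsub>R\<^esub>,
     add = (\<lambda>U V. \<Union>(a, s)\<in>U. \<Union>(b, t)\<in>V.
        loc_frac R S ((a \<otimes>\<^bsub>R\<^esub> t) \<oplus>\<^bsub>R\<^esub> (b \<otimes>\<^bsub>R\<^esub> s)) (s \<otimes>\<^bsub>R\<^esub> t))\<rparr>"


section \<open>The cluster algebra of the \<open>n\<close>-gon with boundary coefficients\<close>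

text \<open>
  Integer polynomials in variables indexed by pairs: a monomial is a finitely supported
  exponent vector, a polynomial a finitely supported family of integer coefficients.
\<close>

type_synonym segment_poly = "((nat \<times> nat) \<Rightarrow>\<^sub>0 nat) \<Rightarrow>\<^sub>0 int"

definition poly_ring :: "nat \<Rightarrow> segment_poly ring" where
  "poly_ring n = ring_of_type_algebra
     \<lparr>carrier := {P. \<forall>m\<in>Poly_Mapping.keys P. Poly_Mapping.keys m \<subseteq> segments n}\<rparr>"

definition seg_var :: "nat \<Rightarrow> nat \<Rightarrow> segment_poly" where
  "seg_var i j = Poly_Mapping.single (Poly_Mapping.single (i, j) 1) 1"

definition plucker_ideal :: "nat \<Rightarrow> segment_poly set" where
  "plucker_ideal n = genideal (poly_ring n)
     {seg_var i k * seg_var j l - (seg_var i j * seg_var k l + seg_var i l * seg_var j k) | i j k l.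
        1 \<le> i \<and> i < j \<and> j < k \<and> k < l \<and> l \<le> n}"

definition plucker_algebra :: "nat \<Rightarrow> segment_poly set ring" where
  "plucker_algebra n = poly_ring n Quot plucker_ideal n"

definition plucker_var :: "nat \<Rightarrow> nat \<times> nat \<Rightarrow> segment_poly set" where
  "plucker_var n s = plucker_ideal n +>\<^bsub>poly_ring n\<^esub> seg_var (fst s) (snd s)"

definition edge_monoid :: "nat \<Rightarrow> segment_poly set set" where
  "edge_monoid n = mult_closure (plucker_algebra n) (plucker_var n ` edges n)"

type_synonym cluster_element = "(segment_poly set \<times> segment_poly set) set"

definition cluster_algebra :: "nat \<Rightarrow> cluster_element ring" where
  "cluster_algebra n = localization (plucker_algebra n) (edge_monoid n)"

text \<open>The image of \<open>x\<^sub>i\<^sub>,\<^sub>j\<close> in the cluster algebra, for a segment \<open>s = (i, j)\<close>.\<close>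

definition cluster_var :: "nat \<Rightarrow> nat \<times> nat \<Rightarrow> cluster_element" where
  "cluster_var n s = loc_frac (plucker_algebra n) (edge_monoid n)
             (plucker_var n s) \<one>\<^bsub>plucker_algebra n\<^esub>"


section \<open>The cluster variety and its deep locus\<close>

text \<open>
  \<open>Hom(A, k)\<close>.  Homomorphisms are taken to be \<open>undefined\<close> outside of
  the carrier, so that equality of points is equality of HOL functions.
\<close>

definition cluster_variety :: "nat \<Rightarrow> (cluster_element \<Rightarrow> 'k::field) set" where
  "cluster_variety n =
     ring_hom (cluster_algebra n) ring_of_type_algebra \<inter> extensional (carrier (cluster_algebra n))"

definition deep_locus :: "nat \<Rightarrow> (cluster_element \<Rightarrow> 'k::field) set" where
  "deep_locus n = {p \<in> cluster_variety n.
     \<forall>T. triangulation n T \<longrightarrow> (\<exists>s\<in>T \<inter> diagonals n. p (cluster_var n s) = 0)}"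

definition extends :: "nat \<Rightarrow> (nat \<times> nat \<Rightarrow> 'k) \<Rightarrow> (cluster_element \<Rightarrow> 'k) \<Rightarrow> bool" where
  "extends n w p \<longleftrightarrow> (\<forall>e\<in>edges n. p (cluster_var n e) = w e)"


section \<open>Isomorphism of varieties\<close>

text \<open>
  A variety over \<open>k\<close> is given by its set \<open>V\<close> of points together with a set \<open>F\<close> of functions
  generating its \<open>k\<close>-algebra of regular functions.
\<close>

inductive_set algebra_generated :: "('p \<Rightarrow> 'k::field) set \<Rightarrow> ('p \<Rightarrow> 'k) set"
  for F where
  const: "(\<lambda>_. c) \<in> algebra_generated F"
| gen: "f \<in> F \<Longrightarrow> f \<in> algebra_generated F"
| add: "\<lbrakk>f \<in> algebra_generated F; g \<in> algebra_generated F\<rbrakk>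
          \<Longrightarrow> (\<lambda>p. f p + g p) \<in> algebra_generated F"
| mult: "\<lbrakk>f \<in> algebra_generated F; g \<in> algebra_generated F\<rbrakk>
          \<Longrightarrow> (\<lambda>p. f p * g p) \<in> algebra_generated F"

definition regular_on :: "'p set \<Rightarrow> ('p \<Rightarrow> 'k::field) set \<Rightarrow> ('p \<Rightarrow> 'k) \<Rightarrow> bool" where
  "regular_on V F f \<longleftrightarrow> (\<exists>g\<in>algebra_generated F. \<forall>p\<in>V. f p = g p)"

text \<open>
  The Zariski closed sets are the common zero sets of regular functions, so an isomorphism in
  this sense is in particular a homeomorphism for the Zariski topologies.
\<close>

definition variety_iso ::
  "'p set \<Rightarrow> ('p \<Rightarrow> 'k::field) set \<Rightarrow> 'q set \<Rightarrow> ('q \<Rightarrow> 'k) set \<Rightarrow> ('p \<Rightarrow> 'q) \<Rightarrow> bool" where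
  "variety_iso V F W G \<phi> \<longleftrightarrow>
     bij_betw \<phi> V W \<and> (\<forall>f. regular_on W G f \<longleftrightarrow> regular_on V F (\<lambda>p. f (\<phi> p)))"

text \<open>
  On subsets of the cluster variety the regular functions are the restrictions of elements of
  \<open>k \<otimes> A\<close>.
\<close>

definition cluster_functions :: "nat \<Rightarrow> ((cluster_element \<Rightarrow> 'k::field) \<Rightarrow> 'k) set" where
  "cluster_functions n = {\<lambda>p. p a | a. a \<in> carrier (cluster_algebra n)}"

definition torus :: "nat \<Rightarrow> (nat \<Rightarrow> 'k::field) set" where
  "torus m = {1..m} \<rightarrow>\<^sub>E (UNIV - {0})"

definition torus_functions :: "nat \<Rightarrow> ((nat \<Rightarrow> 'k::field) \<Rightarrow> 'k) set" where
  "torus_functions m = {\<lambda>t. t i | i. i \<in> {1..m}} \<union> {\<lambda>t. inverse (t i) | i. i \<in> {1..m}}"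

end

theory Submission
  imports Defs
begin

text \<open>
  A homomorphism from the cluster algebra to a field is the same as a vector of values
  \<open>x\<^sub>i\<^sub>j\<close> on the segments which satisfies the Pluecker relations and is nonzero on the edges:
  the polynomial ring, its quotient and the localization each have a universal property
  (\<open>cluster_variety_of_plucker_point\<close>), and a homomorphism is determined by its values on the
  segments (\<open>cluster_point_eqI\<close>).  Everything after that is about such vectors.

  The Pluecker relations through the vertices \<open>1\<close> and \<open>2\<close> say that \<open>x\<^sub>i\<^sub>j\<close> is, up to the nonzero factor
  \<open>x\<^sub>1\<^sub>2\<close>, the determinant of the plane vectors \<open>(x\<^sub>1\<^sub>i, x\<^sub>2\<^sub>i)\<close> and \<open>(x\<^sub>1\<^sub>j, x\<^sub>2\<^sub>j)\<close>.  These vectors are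
  nonzero, so each vertex has a colour, namely the line spanned by its vector, and \<open>x\<^sub>i\<^sub>j\<close> vanishes exactly
  when \<open>i\<close> and \<open>j\<close> have the same colour (\<open>plucker_colouring\<close>).  Neighbouring vertices have different
  colours.  A point is therefore deep when no triangulation uses bichromatic segments only.

  If at least three colours occur, such a triangulation exists (\<open>bichromatic_triangulation\<close>):
  there is a vertex whose two neighbours have different colours; either its colour occurs nowhere
  else and the fan at this vertex will do, or it can be cut off without losing a colour.  So a deep
  point has two colours, which alternate around the polygon.  Hence \<open>n\<close> is even and
  \<open>x\<^sub>i\<^sub>j = 0\<close> exactly when \<open>i\<close> and \<open>j\<close> have the same parity (\<open>deep_vector_zero_iff\<close>).  The Pluecker relation on
  \<open>i, j, j + 1, j + 2\<close> then loses its left-hand side and becomes a two-term recursion for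
  \<open>x\<^sub>i\<^sub>,\<^sub>j\<^sub>+\<^sub>2\<close>, whose solution is the alternating product (\<open>deep_vector_value\<close>); for the edge
  \<open>(1, n)\<close> it is the condition on the edges.

  Conversely, let the vectors of the odd vertices lie on one axis and those of the even vertices on
  the other.  Determinants of plane vectors satisfy the Pluecker relations, the lengths can be chosen
  one after another so that the edges \<open>(1, 2), \<dots>, (n - 1, n)\<close> get any prescribed nonzero values, and the
  point is deep because for even \<open>n\<close> every triangulation contains a diagonal between vertices of
  the same parity (\<open>same_parity_diagonal_in_triangulation\<close>).  So the values on these \<open>n - 1\<close> edges are
  coordinates that identify the deep locus with a torus.  The inverse is regular because all values of a
  deep point are Laurent monomials in the coordinates, up to sign (\<open>path_ratio_torus\<close>).
\<close>

section \<open>Integer polynomials in the segment variables\<close>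

lemma ring_of_type_algebra_simps [simp]:
  "carrier (ring_of_type_algebra :: 'a::comm_ring_1 ring) = UNIV"
  "(x :: 'a) \<otimes>\<^bsub>ring_of_type_algebra\<^esub> y = x * y"
  "(x :: 'a) \<oplus>\<^bsub>ring_of_type_algebra\<^esub> y = x + y"
  "\<one>\<^bsub>(ring_of_type_algebra :: 'a ring)\<^esub> = 1"
  "\<zero>\<^bsub>(ring_of_type_algebra :: 'a ring)\<^esub> = 0"
  by (simp_all add: ring_of_type_algebra_def)

lemma poly_ring_simps [simp]:
  "P \<otimes>\<^bsub>poly_ring n\<^esub> Q = P * Q"
  "P \<oplus>\<^bsub>poly_ring n\<^esub> Q = P + Q"
  "\<one>\<^bsub>poly_ring n\<^esub> = 1"
  "\<zero>\<^bsub>poly_ring n\<^esub> = 0"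
  by (simp_all add: poly_ring_def ring_of_type_algebra_def)

lemma mem_carrier_poly_ring:
  "P \<in> carrier (poly_ring n) \<longleftrightarrow> (\<forall>m\<in>Poly_Mapping.keys P. Poly_Mapping.keys m \<subseteq> segments n)"
  by (simp add: poly_ring_def)

lemma poly_ring_closed:
  shows "0 \<in> carrier (poly_ring n)" "1 \<in> carrier (poly_ring n)"
    and "\<lbrakk>P \<in> carrier (poly_ring n); Q \<in> carrier (poly_ring n)\<rbrakk> \<Longrightarrow> P + Q \<in> carrier (poly_ring n)"
    and "P \<in> carrier (poly_ring n) \<Longrightarrow> - P \<in> carrier (poly_ring n)"
    and "\<lbrakk>P \<in> carrier (poly_ring n); Q \<in> carrier (poly_ring n)\<rbrakk> \<Longrightarrow> P * Q \<in> carrier (poly_ring n)"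
    and "\<lbrakk>P \<in> carrier (poly_ring n); Q \<in> carrier (poly_ring n)\<rbrakk> \<Longrightarrow> P - Q \<in> carrier (poly_ring n)"
proof -
  show "0 \<in> carrier (poly_ring n)" "1 \<in> carrier (poly_ring n)"
    by (simp_all add: mem_carrier_poly_ring)
  show add: "A + B \<in> carrier (poly_ring n)"
    if "A \<in> carrier (poly_ring n)" "B \<in> carrier (poly_ring n)" for A B
    using that keys_add[of A B] unfolding mem_carrier_poly_ring by blast
  show neg: "- A \<in> carrier (poly_ring n)" if "A \<in> carrier (poly_ring n)" for A
    using that by (simp add: mem_carrier_poly_ring in_keys_iff)
  show "P - Q \<in> carrier (poly_ring n)"
    if "P \<in> carrier (poly_ring n)" "Q \<in> carrier (poly_ring n)"
    using add[OF that(1) neg[OF that(2)]] by simp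
  show "P * Q \<in> carrier (poly_ring n)"
    if "P \<in> carrier (poly_ring n)" "Q \<in> carrier (poly_ring n)"
    unfolding mem_carrier_poly_ring
  proof
    fix m assume "m \<in> Poly_Mapping.keys (P * Q)"
    then obtain a b where "a \<in> Poly_Mapping.keys P" "b \<in> Poly_Mapping.keys Q" "m = a + b"
      using keys_mult[of P Q] by blast
    then show "Poly_Mapping.keys m \<subseteq> segments n"
      using that keys_add[of a b] unfolding mem_carrier_poly_ring by blast
  qed
qed

lemma cring_poly_ring: "cring (poly_ring n)"
proof (rule cringI)
  show "abelian_group (poly_ring n)"
  proof (rule abelian_groupI)
    fix P assume "P \<in> carrier (poly_ring n)"
    then show "\<exists>Q\<in>carrier (poly_ring n). Q \<oplus>\<^bsub>poly_ring n\<^esub> P = \<zero>\<^bsub>poly_ring n\<^esub>"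
      by (intro bexI[of _ "- P"]) (simp_all add: poly_ring_closed)
  qed (simp_all add: poly_ring_closed algebra_simps)
  show "Group.comm_monoid (poly_ring n)"
    by (rule comm_monoidI) (simp_all add: poly_ring_closed algebra_simps)
qed (simp add: algebra_simps)

lemma seg_var_closed:
  assumes "(i, j) \<in> segments n"
  shows "seg_var i j \<in> carrier (poly_ring n)"
  using assms by (simp add: seg_var_def mem_carrier_poly_ring)

lemma poly_mapping_eq_sum_single:
  "P = (\<Sum>m\<in>Poly_Mapping.keys P. Poly_Mapping.single m (Poly_Mapping.lookup P m))"
proof (rule poly_mapping_eqI)
  fix k
  show "Poly_Mapping.lookup P k =
    Poly_Mapping.lookup (\<Sum>m\<in>Poly_Mapping.keys P. Poly_Mapping.single m (Poly_Mapping.lookup P m)) k"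
    by (simp add: lookup_sum lookup_single when_def sum.delta in_keys_iff)
qed

text \<open>
  The polynomial ring is generated by the variables: a monomial is built by multiplying with one
  variable at a time, integer coefficients by adding and subtracting \<open>1\<close>.  This is how statements about
  homomorphisms on the polynomial ring are reduced to the segment variables.
\<close>

lemma poly_ring_induct [consumes 1, case_names one var add neg mult]:
  assumes P: "P \<in> carrier (poly_ring n)"
    and one: "Q 1"
    and var: "\<And>i j. (i, j) \<in> segments n \<Longrightarrow> Q (seg_var i j)"
    and add: "\<And>A B. \<lbrakk>A \<in> carrier (poly_ring n); B \<in> carrier (poly_ring n); Q A; Q B\<rbrakk> \<Longrightarrow> Q (A + B)"
    and neg: "\<And>A. \<lbrakk>A \<in> carrier (poly_ring n); Q A\<rbrakk> \<Longrightarrow> Q (- A)"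
    and mult: "\<And>A B. \<lbrakk>A \<in> carrier (poly_ring n); B \<in> carrier (poly_ring n); Q A; Q B\<rbrakk> \<Longrightarrow> Q (A * B)"
  shows "Q P"
proof -
  let ?C = "carrier (poly_ring n)"
  note C0 = poly_ring_closed(1)[of n] and C1 = poly_ring_closed(2)[of n]
  have zero: "Q 0"
    using add[OF C1 poly_ring_closed(4)[OF C1] one neg[OF C1 one]] by simp
  have const: "of_int c \<in> ?C \<and> Q (of_int c)" for c
  proof (induction c rule: int_induct[where k = 0])
    case base
    then show ?case using zero C0 by simp
  next
    case (step1 i)
    then have "of_int i + 1 \<in> ?C \<and> Q (of_int i + 1)"
      by (intro conjI add poly_ring_closed(3) C1 one) (auto simp only:)
    then show ?case by (simp only: of_int_add of_int_1)
  next
    case (step2 i)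
    then have "of_int i + (- 1) \<in> ?C \<and> Q (of_int i + (- 1))"
      by (intro conjI add neg poly_ring_closed(3,4) C1 one) (auto simp only:)
    then show ?case by (simp only: of_int_add of_int_minus of_int_1 diff_conv_add_uminus)
  qed
  have monom: "Poly_Mapping.keys m \<subseteq> segments n \<longrightarrow> Poly_Mapping.single m 1 \<in> ?C \<and> Q (Poly_Mapping.single m 1)"
    for m :: "(nat \<times> nat) \<Rightarrow>\<^sub>0 nat"
  proof (induction "sum (Poly_Mapping.lookup m) (Poly_Mapping.keys m)" arbitrary: m rule: less_induct)
    case less
    show ?case
    proof (cases "Poly_Mapping.keys m = {}")
      case True
      then have "m = 0" by simp
      then show ?thesis using one C1 by simp
    next
      case False
      show ?thesis
      proof
        assume sub: "Poly_Mapping.keys m \<subseteq> segments n"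
        from False obtain i j where ij: "(i, j) \<in> Poly_Mapping.keys m" by fastforce
        let ?e = "Poly_Mapping.single (i, j) (1::nat)"
        define m' where "m' = m - ?e"
        have pos: "Poly_Mapping.lookup m (i, j) > 0"
          using ij by (simp add: in_keys_iff)
        have look: "Poly_Mapping.lookup m' k = Poly_Mapping.lookup m k - (if k = (i, j) then 1 else 0)" for k
          by (simp add: m'_def lookup_minus lookup_single when_def)
        have m: "m = ?e + m'"
          using pos by (intro poly_mapping_eqI) (auto simp: look lookup_add lookup_single when_def)
        have keys: "Poly_Mapping.keys m' \<subseteq> Poly_Mapping.keys m"
          by (auto simp: in_keys_iff look)
        have "sum (Poly_Mapping.lookup m') (Poly_Mapping.keys m') \<le> sum (Poly_Mapping.lookup m') (Poly_Mapping.keys m)"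
          using keys by (intro sum_mono2) auto
        also have "\<dots> < sum (Poly_Mapping.lookup m) (Poly_Mapping.keys m)"
          by (rule sum_strict_mono_ex1) (use ij pos in \<open>auto simp: look\<close>)
        finally have IH: "Poly_Mapping.single m' 1 \<in> ?C \<and> Q (Poly_Mapping.single m' 1)"
          using less keys sub by blast
        have "Poly_Mapping.single m 1 = seg_var i j * Poly_Mapping.single m' 1"
          unfolding seg_var_def mult_single m[symmetric] by simp
        moreover have "(i, j) \<in> segments n" using ij sub by blast
        ultimately show "Poly_Mapping.single m 1 \<in> ?C \<and> Q (Poly_Mapping.single m 1)"
          using IH mult var seg_var_closed poly_ring_closed(5) by metis
      qed
    qed
  qed
  have term': "Poly_Mapping.single m c \<in> ?C \<and> Q (Poly_Mapping.single m c)"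
    if "Poly_Mapping.keys m \<subseteq> segments n" for m and c :: int
  proof -
    have "Poly_Mapping.single m c = of_int c * Poly_Mapping.single m 1"
      by (simp add: mult_single flip: single_of_int)
    then show ?thesis
      using that monom const mult poly_ring_closed(5) by metis
  qed
  have "(\<Sum>m\<in>M. Poly_Mapping.single m (Poly_Mapping.lookup P m)) \<in> ?C \<and>
        Q (\<Sum>m\<in>M. Poly_Mapping.single m (Poly_Mapping.lookup P m))"
    if "finite M" "M \<subseteq> Poly_Mapping.keys P" for M
    using that
  proof (induction M rule: finite_induct)
    case empty
    then show ?case using zero C0 by simp
  next
    case (insert m M)
    have "Poly_Mapping.keys m \<subseteq> segments n"
      using P insert.prems by (simp add: mem_carrier_poly_ring)
    then have m: "Poly_Mapping.single m (Poly_Mapping.lookup P m) \<in> ?C \<and>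
        Q (Poly_Mapping.single m (Poly_Mapping.lookup P m))"
      by (rule term')
    have M: "(\<Sum>m\<in>M. Poly_Mapping.single m (Poly_Mapping.lookup P m)) \<in> ?C \<and>
        Q (\<Sum>m\<in>M. Poly_Mapping.single m (Poly_Mapping.lookup P m))"
      using insert by blast
    show ?case
      unfolding sum.insert[OF insert.hyps]
      by (intro conjI poly_ring_closed(3) add) (use m M in \<open>simp_all only:\<close>)
  qed
  from this[OF finite_keys subset_refl] show ?thesis
    by (simp only: poly_mapping_eq_sum_single[symmetric])
qed

definition monom_value :: "(nat \<times> nat \<Rightarrow> 'k::field) \<Rightarrow> ((nat \<times> nat) \<Rightarrow>\<^sub>0 nat) \<Rightarrow> 'k" where
  "monom_value v m = (\<Prod>s\<in>Poly_Mapping.keys m. v s ^ Poly_Mapping.lookup m s)"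

definition poly_value :: "(nat \<times> nat \<Rightarrow> 'k::field) \<Rightarrow> segment_poly \<Rightarrow> 'k" where
  "poly_value v P = (\<Sum>m\<in>Poly_Mapping.keys P. of_int (Poly_Mapping.lookup P m) * monom_value v m)"

lemma monom_value_superset:
  assumes "finite A" "Poly_Mapping.keys m \<subseteq> A"
  shows "monom_value v m = (\<Prod>s\<in>A. v s ^ Poly_Mapping.lookup m s)"
  unfolding monom_value_def using assms
  by (intro prod.mono_neutral_left) (auto simp: in_keys_iff)

lemma monom_value_add: "monom_value v (a + b) = monom_value v a * monom_value v b"
proof -
  let ?A = "Poly_Mapping.keys a \<union> Poly_Mapping.keys b"
  have "monom_value v (a + b) = (\<Prod>s\<in>?A. v s ^ Poly_Mapping.lookup (a + b) s)"
    by (intro monom_value_superset finite_UnI finite_keys keys_add)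
  also have "\<dots> = (\<Prod>s\<in>?A. v s ^ Poly_Mapping.lookup a s) * (\<Prod>s\<in>?A. v s ^ Poly_Mapping.lookup b s)"
    by (simp add: lookup_add power_add prod.distrib)
  also have "\<dots> = monom_value v a * monom_value v b"
    using monom_value_superset[of ?A a v] monom_value_superset[of ?A b v] by simp
  finally show ?thesis .
qed

lemma poly_value_superset:
  assumes "finite A" "Poly_Mapping.keys P \<subseteq> A"
  shows "poly_value v P = (\<Sum>m\<in>A. of_int (Poly_Mapping.lookup P m) * monom_value v m)"
  unfolding poly_value_def using assms
  by (intro sum.mono_neutral_left) (auto simp: in_keys_iff)

lemma poly_value_add: "poly_value v (P + Q) = poly_value v P + poly_value v Q"
proof -
  let ?A = "Poly_Mapping.keys P \<union> Poly_Mapping.keys Q"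
  have "poly_value v (P + Q) = (\<Sum>m\<in>?A. of_int (Poly_Mapping.lookup (P + Q) m) * monom_value v m)"
    by (intro poly_value_superset finite_UnI finite_keys keys_add)
  also have "\<dots> = poly_value v P + poly_value v Q"
    using poly_value_superset[of ?A P v] poly_value_superset[of ?A Q v]
    by (simp add: lookup_add distrib_right sum.distrib)
  finally show ?thesis .
qed

lemma poly_value_sum: "poly_value v (sum f A) = (\<Sum>a\<in>A. poly_value v (f a))"
  by (induction A rule: infinite_finite_induct) (simp_all add: poly_value_add, simp_all add: poly_value_def)

lemma poly_value_single: "poly_value v (Poly_Mapping.single m c) = of_int c * monom_value v m"
  by (simp add: poly_value_def)

lemma poly_value_mult: "poly_value v (P * Q) = poly_value v P * poly_value v Q"
proof -
  have "poly_value v (P * Q) = poly_value v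
     ((\<Sum>m\<in>Poly_Mapping.keys P. Poly_Mapping.single m (Poly_Mapping.lookup P m)) *
      (\<Sum>m\<in>Poly_Mapping.keys Q. Poly_Mapping.single m (Poly_Mapping.lookup Q m)))"
    by (simp only: poly_mapping_eq_sum_single[symmetric])
  also have "\<dots> = poly_value v P * poly_value v Q"
    unfolding sum_product poly_value_sum mult_single poly_value_single monom_value_add
      poly_value_def[of v P] poly_value_def[of v Q]
    by (intro sum.cong refl) (simp only: of_int_mult mult_ac)
  finally show ?thesis .
qed

lemma poly_value_one: "poly_value v 1 = 1"
  unfolding single_one[symmetric] poly_value_single by (simp add: monom_value_def)

lemma poly_value_seg_var: "poly_value v (seg_var i j) = v (i, j)"
  by (simp add: seg_var_def poly_value_single monom_value_def)

lemma poly_value_diff: "poly_value v (P - Q) = poly_value v P - poly_value v Q"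
  using poly_value_add[of v "P - Q" Q] by simp

lemma poly_value_hom: "poly_value v \<in> ring_hom (poly_ring n) ring_of_type_algebra"
  by (rule ring_hom_memI) (auto simp: poly_value_add poly_value_mult poly_value_one)

section \<open>Fractions\<close>

locale localization_setting = cring R for R (structure) +
  fixes S
  assumes S_sub: "S \<subseteq> carrier R" and S_one: "\<one> \<in> S"
    and S_mult: "\<lbrakk>s \<in> S; t \<in> S\<rbrakk> \<Longrightarrow> s \<otimes> t \<in> S"
begin

lemma S_carr: "s \<in> S \<Longrightarrow> s \<in> carrier R"
  using S_sub by blast

lemma equiv_frac_rel: "equiv (carrier R \<times> S) (frac_rel R S)"
proof (rule equivI)
  show "frac_rel R S \<subseteq> (carrier R \<times> S) \<times> (carrier R \<times> S)"
    by (auto simp: frac_rel_def)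
  show "refl_on (carrier R \<times> S) (frac_rel R S)"
    using S_one by (auto simp: refl_on_def frac_rel_def)
  show "sym (frac_rel R S)"
    by (rule symI) (auto simp: frac_rel_def, metis)
  show "trans (frac_rel R S)"
  proof (rule transI, clarify)
    fix a s b t c r
    assume "((a, s), (b, t)) \<in> frac_rel R S" "((b, t), (c, r)) \<in> frac_rel R S"
    then obtain u w where c: "a \<in> carrier R" "b \<in> carrier R" "c \<in> carrier R" "s \<in> S" "t \<in> S" "r \<in> S"
      "u \<in> S" "w \<in> S" and u: "u \<otimes> (a \<otimes> t) = u \<otimes> (b \<otimes> s)" and w: "w \<otimes> (b \<otimes> r) = w \<otimes> (c \<otimes> t)"
      by (auto simp: frac_rel_def)
    note c' = c S_carr[OF c(4)] S_carr[OF c(5)] S_carr[OF c(6)] S_carr[OF c(7)] S_carr[OF c(8)]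
    \<comment> \<open>\<open>t\<close> is cancelled by absorbing it into the multiplier.\<close>
    have "(u \<otimes> w \<otimes> t) \<otimes> (a \<otimes> r) = (w \<otimes> r) \<otimes> (u \<otimes> (a \<otimes> t))"
      using c' by (simp add: m_ac)
    also have "\<dots> = (u \<otimes> s) \<otimes> (w \<otimes> (b \<otimes> r))"
      unfolding u using c' by (simp add: m_ac)
    also have "\<dots> = (u \<otimes> w \<otimes> t) \<otimes> (c \<otimes> s)"
      unfolding w using c' by (simp add: m_ac)
    finally show "((a, s), (c, r)) \<in> frac_rel R S"
      using c S_mult by (auto simp: frac_rel_def intro!: bexI[of _ "u \<otimes> w \<otimes> t"])
  qed
qed

lemma loc_frac_eq_iff:
  assumes "a \<in> carrier R" "b \<in> carrier R" "s \<in> S" "t \<in> S"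
  shows "loc_frac R S a s = loc_frac R S b t \<longleftrightarrow> (\<exists>u\<in>S. u \<otimes> (a \<otimes> t) = u \<otimes> (b \<otimes> s))"
  unfolding loc_frac_def
  by (subst eq_equiv_class_iff[OF equiv_frac_rel]) (use assms in \<open>auto simp: frac_rel_def\<close>)

lemma loc_frac_eqI:
  assumes "a \<in> carrier R" "b \<in> carrier R" "s \<in> S" "t \<in> S" "a \<otimes> t = b \<otimes> s"
  shows "loc_frac R S a s = loc_frac R S b t"
  unfolding loc_frac_eq_iff[OF assms(1-4)] using assms(5) S_one by auto

lemma mem_loc_frac:
  assumes "a \<in> carrier R" "s \<in> S"
  shows "(b, t) \<in> loc_frac R S a s \<longleftrightarrow>
    b \<in> carrier R \<and> t \<in> S \<and> loc_frac R S b t = loc_frac R S a s"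
proof -
  have "(b, t) \<in> loc_frac R S a s \<longleftrightarrow> ((a, s), (b, t)) \<in> frac_rel R S"
    by (simp add: loc_frac_def)
  also have "\<dots> \<longleftrightarrow> b \<in> carrier R \<and> t \<in> S \<and> loc_frac R S a s = loc_frac R S b t"
    using assms by (simp add: loc_frac_eq_iff frac_rel_def cong: conj_cong)
  finally show ?thesis by auto
qed

lemma carrier_localization:
  "carrier (localization R S) = {loc_frac R S a s | a s. a \<in> carrier R \<and> s \<in> S}"
  by (auto simp: localization_def quotient_def loc_frac_def)

lemma loc_frac_closed: "\<lbrakk>a \<in> carrier R; s \<in> S\<rbrakk> \<Longrightarrow> loc_frac R S a s \<in> carrier (localization R S)"
  by (auto simp: carrier_localization)

text \<open>
  A union over all representatives collapses to a single class as soon as the class does not depend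
  on them.
\<close>

lemma UN_loc_frac_eq:
  assumes a: "a \<in> carrier R" "s \<in> S" and b: "b \<in> carrier R" "t \<in> S"
    and cong: "\<And>a' s' b' t'. \<lbrakk>a' \<in> carrier R; s' \<in> S; b' \<in> carrier R; t' \<in> S;
      loc_frac R S a' s' = loc_frac R S a s; loc_frac R S b' t' = loc_frac R S b t\<rbrakk> \<Longrightarrow> F a' s' b' t' = Y"
  shows "(\<Union>(a', s')\<in>loc_frac R S a s. \<Union>(b', t')\<in>loc_frac R S b t. F a' s' b' t') = Y"
proof -
  have "(a, s) \<in> loc_frac R S a s" "(b, t) \<in> loc_frac R S b t"
    using a b by (simp_all add: mem_loc_frac)
  moreover have "F a' s' b' t' = Y" if "(a', s') \<in> loc_frac R S a s" "(b', t') \<in> loc_frac R S b t" for a' s' b' t'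
    using that a b by (intro cong) (simp_all add: mem_loc_frac)
  ultimately show ?thesis
    by fastforce
qed

lemma mult_loc_frac:
  assumes a: "a \<in> carrier R" "s \<in> S" and b: "b \<in> carrier R" "t \<in> S"
  shows "loc_frac R S a s \<otimes>\<^bsub>localization R S\<^esub> loc_frac R S b t = loc_frac R S (a \<otimes> b) (s \<otimes> t)"
proof -
  have "(\<Union>(a', s')\<in>loc_frac R S a s. \<Union>(b', t')\<in>loc_frac R S b t. loc_frac R S (a' \<otimes> b') (s' \<otimes> t'))
    = loc_frac R S (a \<otimes> b) (s \<otimes> t)"
  proof (rule UN_loc_frac_eq[OF a b])
    fix a' s' b' t'
    assume c: "a' \<in> carrier R" "s' \<in> S" "b' \<in> carrier R" "t' \<in> S"
      and eq: "loc_frac R S a' s' = loc_frac R S a s" "loc_frac R S b' t' = loc_frac R S b t"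
    obtain u w where uw: "u \<in> S" "w \<in> S" and u: "u \<otimes> (a' \<otimes> s) = u \<otimes> (a \<otimes> s')"
      and w: "w \<otimes> (b' \<otimes> t) = w \<otimes> (b \<otimes> t')"
      using eq a b c by (auto simp: loc_frac_eq_iff)
    note cc = a b c uw S_carr[OF a(2)] S_carr[OF b(2)] S_carr[OF c(2)] S_carr[OF c(4)] S_carr[OF uw(1)] S_carr[OF uw(2)]
    have "(u \<otimes> w) \<otimes> ((a' \<otimes> b') \<otimes> (s \<otimes> t)) = (u \<otimes> (a' \<otimes> s)) \<otimes> (w \<otimes> (b' \<otimes> t))"
      using cc by (simp add: m_ac)
    also have "\<dots> = (u \<otimes> w) \<otimes> ((a \<otimes> b) \<otimes> (s' \<otimes> t'))"
      unfolding u w using cc by (simp add: m_ac)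
    finally show "loc_frac R S (a' \<otimes> b') (s' \<otimes> t') = loc_frac R S (a \<otimes> b) (s \<otimes> t)"
      using cc S_mult by (subst loc_frac_eq_iff) auto
  qed
  then show ?thesis by (simp add: localization_def)
qed

lemma add_loc_frac:
  assumes a: "a \<in> carrier R" "s \<in> S" and b: "b \<in> carrier R" "t \<in> S"
  shows "loc_frac R S a s \<oplus>\<^bsub>localization R S\<^esub> loc_frac R S b t
    = loc_frac R S ((a \<otimes> t) \<oplus> (b \<otimes> s)) (s \<otimes> t)"
proof -
  have "(\<Union>(a', s')\<in>loc_frac R S a s. \<Union>(b', t')\<in>loc_frac R S b t.
      loc_frac R S ((a' \<otimes> t') \<oplus> (b' \<otimes> s')) (s' \<otimes> t'))
    = loc_frac R S ((a \<otimes> t) \<oplus> (b \<otimes> s)) (s \<otimes> t)"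
  proof (rule UN_loc_frac_eq[OF a b])
    fix a' s' b' t'
    assume c: "a' \<in> carrier R" "s' \<in> S" "b' \<in> carrier R" "t' \<in> S"
      and eq: "loc_frac R S a' s' = loc_frac R S a s" "loc_frac R S b' t' = loc_frac R S b t"
    obtain u w where uw: "u \<in> S" "w \<in> S" and u: "u \<otimes> (a' \<otimes> s) = u \<otimes> (a \<otimes> s')"
      and w: "w \<otimes> (b' \<otimes> t) = w \<otimes> (b \<otimes> t')"
      using eq a b c by (auto simp: loc_frac_eq_iff)
    note cc = a b c uw S_carr[OF a(2)] S_carr[OF b(2)] S_carr[OF c(2)] S_carr[OF c(4)] S_carr[OF uw(1)] S_carr[OF uw(2)]
    have "(u \<otimes> w) \<otimes> (((a' \<otimes> t') \<oplus> (b' \<otimes> s')) \<otimes> (s \<otimes> t))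
      = (w \<otimes> (t \<otimes> t')) \<otimes> (u \<otimes> (a' \<otimes> s)) \<oplus> (u \<otimes> (s \<otimes> s')) \<otimes> (w \<otimes> (b' \<otimes> t))"
      using cc by (simp add: m_ac r_distr l_distr)
    also have "\<dots> = (u \<otimes> w) \<otimes> (((a \<otimes> t) \<oplus> (b \<otimes> s)) \<otimes> (s' \<otimes> t'))"
      unfolding u w using cc by (simp add: m_ac r_distr l_distr)
    finally show "loc_frac R S ((a' \<otimes> t') \<oplus> (b' \<otimes> s')) (s' \<otimes> t') = loc_frac R S ((a \<otimes> t) \<oplus> (b \<otimes> s)) (s \<otimes> t)"
      using cc S_mult by (subst loc_frac_eq_iff) auto
  qed
  then show ?thesis by (simp add: localization_def)
qed

lemma one_localization: "\<one>\<^bsub>localization R S\<^esub> = loc_frac R S \<one> \<one>"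
  by (simp add: localization_def)

lemma loc_frac_hom: "(\<lambda>a. loc_frac R S a \<one>) \<in> ring_hom R (localization R S)"
  by (rule ring_hom_memI) (simp_all add: loc_frac_closed S_one mult_loc_frac add_loc_frac one_localization)

text \<open>
  A homomorphism into a field sends the denominators to units, since \<open>1/s\<close> is an inverse of \<open>s\<close> in
  the localization.
\<close>

lemma hom_denominator:
  fixes p :: "('a \<times> 'a) set \<Rightarrow> 'k::field"
  assumes p: "p \<in> ring_hom (localization R S) ring_of_type_algebra" and s: "s \<in> S"
  shows "p (loc_frac R S \<one> s) = inverse (p (loc_frac R S s \<one>))" and "p (loc_frac R S s \<one>) \<noteq> 0"
proof -
  note s' = s S_carr[OF s]
  have "loc_frac R S \<one> s \<otimes>\<^bsub>localization R S\<^esub> loc_frac R S s \<one> = \<one>\<^bsub>localization R S\<^esub>"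
    using s' S_one by (simp add: mult_loc_frac one_localization) (rule loc_frac_eqI, simp_all)
  then have *: "p (loc_frac R S \<one> s) * p (loc_frac R S s \<one>) = 1"
    using ring_hom_mult[OF p loc_frac_closed[of \<one> s] loc_frac_closed[of s \<one>]] ring_hom_one[OF p] s' S_one
    by simp
  then show "p (loc_frac R S s \<one>) \<noteq> 0" by auto
  then show "p (loc_frac R S \<one> s) = inverse (p (loc_frac R S s \<one>))"
    using * by (simp add: field_simps)
qed

lemma hom_loc_frac:
  fixes p :: "('a \<times> 'a) set \<Rightarrow> 'k::field"
  assumes p: "p \<in> ring_hom (localization R S) ring_of_type_algebra" and a: "a \<in> carrier R" and s: "s \<in> S"
  shows "p (loc_frac R S a s) = p (loc_frac R S a \<one>) * inverse (p (loc_frac R S s \<one>))"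
proof -
  have "loc_frac R S a s = loc_frac R S a \<one> \<otimes>\<^bsub>localization R S\<^esub> loc_frac R S \<one> s"
    using a s S_one S_carr[OF s] by (simp add: mult_loc_frac)
  then show ?thesis
    using ring_hom_mult[OF p loc_frac_closed loc_frac_closed] a s S_one
    by (simp flip: hom_denominator(1)[OF p s])
qed

text \<open>
  The universal property of the localization, for homomorphisms into a field: a value
  \<open>h a / h s\<close> does not depend on the fraction because \<open>h u\<close> can be cancelled for \<open>u \<in> S\<close>.
\<close>

lemma hom_extends_to_localization:
  fixes h :: "'a \<Rightarrow> 'k::field"
  assumes h: "h \<in> ring_hom R ring_of_type_algebra" and nz: "\<And>s. s \<in> S \<Longrightarrow> h s \<noteq> 0"
  obtains p where "p \<in> ring_hom (localization R S) ring_of_type_algebra"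
    "p \<in> extensional (carrier (localization R S))"
    "\<And>a s. \<lbrakk>a \<in> carrier R; s \<in> S\<rbrakk> \<Longrightarrow> p (loc_frac R S a s) = h a / h s"
proof -
  define p where "p = (\<lambda>U\<in>carrier (localization R S). let x = SOME x. x \<in> U in h (fst x) / h (snd x))"
  note hm = ring_hom_mult[OF h, simplified] and ha = ring_hom_add[OF h, simplified]
    and h1 = ring_hom_one[OF h, simplified]
  have p: "p (loc_frac R S a s) = h a / h s" if a: "a \<in> carrier R" and s: "s \<in> S" for a s
  proof -
    define x where "x = (SOME x. x \<in> loc_frac R S a s)"
    have "(a, s) \<in> loc_frac R S a s"
      using a s by (simp add: mem_loc_frac)
    then have "x \<in> loc_frac R S a s"
      unfolding x_def by (rule someI)
    then obtain b t where x: "x = (b, t)" "b \<in> carrier R" "t \<in> S" "loc_frac R S b t = loc_frac R S a s"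
      using a s by (cases x) (auto simp: mem_loc_frac)
    then obtain u where u: "u \<in> S" "u \<otimes> (b \<otimes> s) = u \<otimes> (a \<otimes> t)"
      using a s by (auto simp: loc_frac_eq_iff)
    then have "h u * (h b * h s) = h u * (h a * h t)"
      using x a s by (metis S_carr hm m_closed)
    then have "h b * h s = h a * h t"
      using nz[OF u(1)] by simp
    then have "h b / h t = h a / h s"
      using nz x(3) s by (simp add: field_simps)
    then show ?thesis
      using loc_frac_closed[OF a s] x(1) by (simp add: p_def flip: x_def)
  qed
  have "p \<in> ring_hom (localization R S) ring_of_type_algebra"
  proof (rule ring_hom_memI)
    fix U V assume "U \<in> carrier (localization R S)" "V \<in> carrier (localization R S)"
    then obtain a s b t where UV: "U = loc_frac R S a s" "V = loc_frac R S b t"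
      and c: "a \<in> carrier R" "s \<in> S" "b \<in> carrier R" "t \<in> S"
      by (auto simp: carrier_localization)
    then show "p (U \<otimes>\<^bsub>localization R S\<^esub> V) = p U \<otimes>\<^bsub>ring_of_type_algebra\<^esub> p V"
      by (simp add: UV mult_loc_frac p S_mult S_carr hm)
    show "p (U \<oplus>\<^bsub>localization R S\<^esub> V) = p U \<oplus>\<^bsub>ring_of_type_algebra\<^esub> p V"
      using c nz[OF c(2)] nz[OF c(4)]
      by (simp add: UV add_loc_frac p S_mult S_carr hm ha add_frac_eq)
  qed (simp_all add: one_localization p S_one h1)
  moreover have "p \<in> extensional (carrier (localization R S))"
    by (simp add: p_def)
  ultimately show ?thesis
    using that p by blast
qed

end

section \<open>Points of the cluster variety are Pluecker vectors\<close>

definition plucker_point :: "nat \<Rightarrow> (nat \<times> nat \<Rightarrow> 'k::field) \<Rightarrow> bool" where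
  "plucker_point n v \<longleftrightarrow>
     (\<forall>i j k l. 1 \<le> i \<and> i < j \<and> j < k \<and> k < l \<and> l \<le> n \<longrightarrow>
        v (i, k) * v (j, l) = v (i, j) * v (k, l) + v (i, l) * v (j, k)) \<and>
     (\<forall>e\<in>edges n. v e \<noteq> 0)"

lemma edge_imp_segment: "e \<in> edges n \<Longrightarrow> e \<in> segments n"
  by (simp add: edges_def split_beta)

lemma plucker_relations_closed:
  "{seg_var i k * seg_var j l - (seg_var i j * seg_var k l + seg_var i l * seg_var j k) | i j k l.
        1 \<le> i \<and> i < j \<and> j < k \<and> k < l \<and> l \<le> n} \<subseteq> carrier (poly_ring n)"
  by (auto intro!: poly_ring_closed seg_var_closed simp: segments_def)

lemma ideal_plucker_ideal: "ideal (plucker_ideal n) (poly_ring n)"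
proof -
  interpret cring "poly_ring n" by (rule cring_poly_ring)
  show ?thesis
    unfolding plucker_ideal_def by (rule genideal_ideal[OF plucker_relations_closed])
qed

lemma cring_plucker_algebra: "cring (plucker_algebra n)"
  unfolding plucker_algebra_def
  by (rule ideal.quotient_is_cring[OF ideal_plucker_ideal cring_poly_ring])

abbreviation poly_class :: "nat \<Rightarrow> segment_poly \<Rightarrow> segment_poly set" where
  "poly_class n P \<equiv> plucker_ideal n +>\<^bsub>poly_ring n\<^esub> P"

lemma poly_class_hom: "poly_class n \<in> ring_hom (poly_ring n) (plucker_algebra n)"
  unfolding plucker_algebra_def by (rule ideal.rcos_ring_hom[OF ideal_plucker_ideal])

lemma carrier_plucker_algebra:
  "carrier (plucker_algebra n) = poly_class n ` carrier (poly_ring n)"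
  by (auto simp: plucker_algebra_def FactRing_def A_RCOSETS_def RCOSETS_def a_r_coset_def)

lemma plucker_var_closed:
  assumes "s \<in> segments n"
  shows "plucker_var n s \<in> carrier (plucker_algebra n)"
  using assms by (auto simp: carrier_plucker_algebra plucker_var_def intro!: imageI seg_var_closed)

lemma edge_monoid_induct [consumes 1, case_names one mult]:
  assumes "s \<in> edge_monoid n" and "Q \<one>\<^bsub>plucker_algebra n\<^esub>"
    and "\<And>s e. \<lbrakk>s \<in> edge_monoid n; e \<in> edges n; Q s\<rbrakk> \<Longrightarrow> Q (s \<otimes>\<^bsub>plucker_algebra n\<^esub> plucker_var n e)"
  shows "Q s"
  using assms(1) unfolding edge_monoid_def
  by (induction rule: mult_closure.induct) (use assms(2,3) in \<open>auto simp: edge_monoid_def\<close>)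

lemma edge_monoid_intros:
  "\<one>\<^bsub>plucker_algebra n\<^esub> \<in> edge_monoid n"
  "\<lbrakk>s \<in> edge_monoid n; e \<in> edges n\<rbrakk> \<Longrightarrow> s \<otimes>\<^bsub>plucker_algebra n\<^esub> plucker_var n e \<in> edge_monoid n"
  unfolding edge_monoid_def by (auto intro: mult_closure.intros)

lemma edge_monoid_closed: "s \<in> edge_monoid n \<Longrightarrow> s \<in> carrier (plucker_algebra n)"
proof (induction rule: edge_monoid_induct)
  interpret cring "plucker_algebra n" by (rule cring_plucker_algebra)
  case one
  show ?case by simp
next
  interpret cring "plucker_algebra n" by (rule cring_plucker_algebra)
  case (mult s e)
  then show ?case using plucker_var_closed[OF edge_imp_segment] by simp
qed

lemma localization_setting_plucker: "localization_setting (plucker_algebra n) (edge_monoid n)"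
proof -
  interpret cring "plucker_algebra n" by (rule cring_plucker_algebra)
  have "s \<otimes>\<^bsub>plucker_algebra n\<^esub> t \<in> edge_monoid n" if s: "s \<in> edge_monoid n" and t: "t \<in> edge_monoid n" for s t
    using t
  proof (induction rule: edge_monoid_induct)
    case one
    then show ?case using s edge_monoid_closed by simp
  next
    case (mult t e)
    have "s \<otimes>\<^bsub>plucker_algebra n\<^esub> (t \<otimes>\<^bsub>plucker_algebra n\<^esub> plucker_var n e)
        = (s \<otimes>\<^bsub>plucker_algebra n\<^esub> t) \<otimes>\<^bsub>plucker_algebra n\<^esub> plucker_var n e"
      using s mult edge_monoid_closed plucker_var_closed edge_imp_segment by (simp only: m_assoc)
    then show ?case
      using edge_monoid_intros(2)[OF mult.IH mult.hyps(2)] by (simp only:)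
  qed
  then show ?thesis
    using edge_monoid_closed by unfold_locales (auto intro: edge_monoid_intros)
qed

lemma plucker_var_in_edge_monoid:
  assumes e: "e \<in> edges n"
  shows "plucker_var n e \<in> edge_monoid n"
proof -
  interpret cring "plucker_algebra n" by (rule cring_plucker_algebra)
  have "\<one>\<^bsub>plucker_algebra n\<^esub> \<otimes>\<^bsub>plucker_algebra n\<^esub> plucker_var n e \<in> edge_monoid n"
    by (intro edge_monoid_intros e)
  then show ?thesis
    using plucker_var_closed[OF edge_imp_segment[OF e]] by simp
qed

definition poly_image :: "nat \<Rightarrow> segment_poly \<Rightarrow> cluster_element" where
  "poly_image n P = loc_frac (plucker_algebra n) (edge_monoid n) (poly_class n P) \<one>\<^bsub>plucker_algebra n\<^esub>"

lemma poly_image_hom: "poly_image n \<in> ring_hom (poly_ring n) (cluster_algebra n)"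
  using ring_hom_trans[OF poly_class_hom localization_setting.loc_frac_hom[OF localization_setting_plucker]]
  unfolding cluster_algebra_def poly_image_def comp_def .

lemma cluster_var_eq: "cluster_var n (i, j) = poly_image n (seg_var i j)"
  by (simp add: cluster_var_def poly_image_def plucker_var_def)

lemma cluster_var_closed:
  assumes "s \<in> segments n"
  shows "cluster_var n s \<in> carrier (cluster_algebra n)"
  using assms ring_hom_closed[OF poly_image_hom seg_var_closed] by (cases s) (simp add: cluster_var_eq)

lemma cluster_varietyD: "p \<in> cluster_variety n \<Longrightarrow> p \<in> ring_hom (cluster_algebra n) ring_of_type_algebra"
  by (simp add: cluster_variety_def)

lemma point_of_poly:
  fixes p :: "cluster_element \<Rightarrow> 'k::field"
  assumes p: "p \<in> cluster_variety n"
  shows "p (poly_image n 1) = 1"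
    and "\<lbrakk>P \<in> carrier (poly_ring n); Q \<in> carrier (poly_ring n)\<rbrakk> \<Longrightarrow> p (poly_image n (P + Q)) = p (poly_image n P) + p (poly_image n Q)"
    and "\<lbrakk>P \<in> carrier (poly_ring n); Q \<in> carrier (poly_ring n)\<rbrakk> \<Longrightarrow> p (poly_image n (P * Q)) = p (poly_image n P) * p (poly_image n Q)"
    and "P \<in> carrier (poly_ring n) \<Longrightarrow> p (poly_image n (- P)) = - p (poly_image n P)"
    and "\<lbrakk>P \<in> carrier (poly_ring n); Q \<in> carrier (poly_ring n)\<rbrakk> \<Longrightarrow> p (poly_image n (P - Q)) = p (poly_image n P) - p (poly_image n Q)"
proof -
  have hom: "p \<circ> poly_image n \<in> ring_hom (poly_ring n) ring_of_type_algebra"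
    by (rule ring_hom_trans[OF poly_image_hom cluster_varietyD[OF p]])
  show "p (poly_image n 1) = 1"
    using ring_hom_one[OF hom] by simp
  show add: "p (poly_image n (A + B)) = p (poly_image n A) + p (poly_image n B)"
    if "A \<in> carrier (poly_ring n)" "B \<in> carrier (poly_ring n)" for A B
    using ring_hom_add[OF hom that] by simp
  show "p (poly_image n (P * Q)) = p (poly_image n P) * p (poly_image n Q)"
    if "P \<in> carrier (poly_ring n)" "Q \<in> carrier (poly_ring n)"
    using ring_hom_mult[OF hom that] by simp
  show diff: "p (poly_image n (A - B)) = p (poly_image n A) - p (poly_image n B)"
    if "A \<in> carrier (poly_ring n)" "B \<in> carrier (poly_ring n)" for A B
    using add[OF poly_ring_closed(6)[OF that] that(2)] by simp
  show "p (poly_image n (- P)) = - p (poly_image n P)" if "P \<in> carrier (poly_ring n)"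
    using diff[OF poly_ring_closed(1) that] diff[OF that that] by simp
qed

lemma edge_value_nonzero:
  fixes p :: "cluster_element \<Rightarrow> 'k::field"
  assumes "p \<in> cluster_variety n" "e \<in> edges n"
  shows "p (cluster_var n e) \<noteq> 0"
proof -
  interpret localization_setting "plucker_algebra n" "edge_monoid n"
    by (rule localization_setting_plucker)
  show ?thesis
    using hom_denominator(2)[OF _ plucker_var_in_edge_monoid[OF assms(2)]] cluster_varietyD[OF assms(1)]
    unfolding cluster_algebra_def cluster_var_def by blast
qed

lemma inverse_edge_value:
  assumes e: "e \<in> edges n"
  obtains a where "a \<in> carrier (cluster_algebra n)"
    "\<And>p :: cluster_element \<Rightarrow> 'k::field. p \<in> cluster_variety n \<Longrightarrow> p a = inverse (p (cluster_var n e))"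
proof -
  interpret localization_setting "plucker_algebra n" "edge_monoid n"
    by (rule localization_setting_plucker)
  note mem = plucker_var_in_edge_monoid[OF e]
  let ?a = "loc_frac (plucker_algebra n) (edge_monoid n) \<one>\<^bsub>plucker_algebra n\<^esub> (plucker_var n e)"
  have "?a \<in> carrier (cluster_algebra n)"
    unfolding cluster_algebra_def using mem by (intro loc_frac_closed) simp_all
  moreover have "p ?a = inverse (p (cluster_var n e))" if "p \<in> cluster_variety n" for p :: "cluster_element \<Rightarrow> 'k"
    using hom_denominator(1)[OF _ mem] cluster_varietyD[OF that]
    unfolding cluster_algebra_def cluster_var_def by blast
  ultimately show ?thesis using that by blast
qed

lemma plucker_point_of_cluster_variety:
  fixes p :: "cluster_element \<Rightarrow> 'k::field"
  assumes p: "p \<in> cluster_variety n"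
  shows "plucker_point n (\<lambda>s. p (cluster_var n s))"
  unfolding plucker_point_def
proof (intro conjI allI impI ballI)
  fix i j k l assume ijkl: "1 \<le> i \<and> i < j \<and> j < k \<and> k < l \<and> l \<le> n"
  let ?P = "seg_var i k * seg_var j l - (seg_var i j * seg_var k l + seg_var i l * seg_var j k)"
  interpret I: ideal "plucker_ideal n" "poly_ring n" by (rule ideal_plucker_ideal)
  have mem: "?P \<in> plucker_ideal n"
    unfolding plucker_ideal_def
    by (rule subsetD[OF I.genideal_self[OF plucker_relations_closed]]) (use ijkl in blast)
  have "poly_class n ?P = poly_class n 0"
    using I.a_rcos_const[OF mem] I.a_rcos_const[OF additive_subgroup.zero_closed[OF I.additive_subgroup_axioms]] by simp
  then have "p (poly_image n ?P) = p (poly_image n 0)"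
    by (simp add: poly_image_def)
  moreover have "p (poly_image n 0) = 0"
    using point_of_poly(5)[OF p poly_ring_closed(1) poly_ring_closed(1)] by simp
  moreover have "(i, j) \<in> segments n" "(i, k) \<in> segments n" "(i, l) \<in> segments n"
    "(j, k) \<in> segments n" "(j, l) \<in> segments n" "(k, l) \<in> segments n"
    using ijkl by (auto simp: segments_def)
  ultimately show "p (cluster_var n (i, k)) * p (cluster_var n (j, l)) =
      p (cluster_var n (i, j)) * p (cluster_var n (k, l)) + p (cluster_var n (i, l)) * p (cluster_var n (j, k))"
    by (simp add: point_of_poly[OF p] poly_ring_closed seg_var_closed cluster_var_eq)
qed (rule edge_value_nonzero[OF p])

text \<open>
  The Pluecker relations hold for the values \<open>v\<close>, so the generators of the ideal lie in the kernel of
  the evaluation at \<open>v\<close>.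
\<close>

lemma poly_value_plucker_ideal:
  fixes v :: "nat \<times> nat \<Rightarrow> 'k::field"
  assumes v: "plucker_point n v" and Q: "Q \<in> plucker_ideal n"
  shows "poly_value v Q = 0"
proof -
  let ?K = "ring_of_type_algebra :: 'k ring"
  have ring: "ring (poly_ring n)" and K: "ring ?K"
    using cring_poly_ring cring.axioms(1) cring_from_type_algebra by blast+
  let ?G = "{seg_var i k * seg_var j l - (seg_var i j * seg_var k l + seg_var i l * seg_var j k) | i j k l.
        1 \<le> i \<and> i < j \<and> j < k \<and> k < l \<and> l \<le> n}"
  have "poly_value v P = 0" if "P \<in> ?G" for P
    using v that
    by (auto simp: plucker_point_def poly_value_diff poly_value_add poly_value_mult poly_value_seg_var)
  then have "?G \<subseteq> a_kernel (poly_ring n) ?K (poly_value v)"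
    using plucker_relations_closed[of n] by (simp only: a_kernel_def' ring_of_type_algebra_simps) blast
  then have "plucker_ideal n \<subseteq> a_kernel (poly_ring n) ?K (poly_value v)"
    unfolding plucker_ideal_def
    by (intro ring.genideal_minimal[OF ring] ring_hom_ring.kernel_is_ideal
        ring_hom_ringI2[OF ring K poly_value_hom])
  then show ?thesis
    using Q by (auto simp: a_kernel_def')
qed

text \<open>
  Evaluation at \<open>v\<close> is constant on the cosets of the Pluecker ideal and sends the edges to nonzero
  values, so it passes first to the quotient and then to the localization.
\<close>

lemma cluster_variety_of_plucker_point:
  fixes v :: "nat \<times> nat \<Rightarrow> 'k::field"
  assumes v: "plucker_point n v"
  obtains p where "p \<in> cluster_variety n" "\<And>s. s \<in> segments n \<Longrightarrow> p (cluster_var n s) = v s"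
proof -
  interpret L: localization_setting "plucker_algebra n" "edge_monoid n"
    by (rule localization_setting_plucker)
  interpret I: ideal "plucker_ideal n" "poly_ring n" by (rule ideal_plucker_ideal)
  note ideal_zero = poly_value_plucker_ideal[OF v]
  \<comment> \<open>The choice of a representative is harmless by \<open>ideal_zero\<close>.\<close>
  define h where "h A = poly_value v (SOME P. P \<in> A)" for A
  have h: "h (poly_class n P) = poly_value v P" if P: "P \<in> carrier (poly_ring n)" for P
  proof -
    define Q where "Q = (SOME Q. Q \<in> poly_class n P)"
    have "Q \<in> poly_class n P"
      unfolding Q_def by (rule someI) (rule I.a_rcos_self[OF P])
    then obtain R where "R \<in> plucker_ideal n" "Q = R + P"
      by (auto simp: a_r_coset_def r_coset_def)
    then show ?thesis
      by (simp add: h_def poly_value_add ideal_zero flip: Q_def)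
  qed
  have hom: "h \<in> ring_hom (plucker_algebra n) ring_of_type_algebra"
  proof (rule ring_hom_memI)
    fix A B assume "A \<in> carrier (plucker_algebra n)" "B \<in> carrier (plucker_algebra n)"
    then obtain P Q where PQ: "A = poly_class n P" "B = poly_class n Q"
        "P \<in> carrier (poly_ring n)" "Q \<in> carrier (poly_ring n)"
      by (auto simp: carrier_plucker_algebra)
    show "h (A \<otimes>\<^bsub>plucker_algebra n\<^esub> B) = h A \<otimes>\<^bsub>ring_of_type_algebra\<^esub> h B"
      using PQ poly_ring_closed
      by (simp add: h poly_value_mult flip: ring_hom_mult[OF poly_class_hom])
    show "h (A \<oplus>\<^bsub>plucker_algebra n\<^esub> B) = h A \<oplus>\<^bsub>ring_of_type_algebra\<^esub> h B"
      using PQ poly_ring_closed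
      by (simp add: h poly_value_add flip: ring_hom_add[OF poly_class_hom])
  next
    show "h \<one>\<^bsub>plucker_algebra n\<^esub> = \<one>\<^bsub>ring_of_type_algebra\<^esub>"
      using ring_hom_one[OF poly_class_hom] h[OF poly_ring_closed(2)] by (simp add: poly_value_one)
  qed simp
  have var: "h (plucker_var n s) = v s" if "s \<in> segments n" for s
    using that h[OF seg_var_closed] by (cases s) (simp add: plucker_var_def poly_value_seg_var)
  have nz: "h s \<noteq> 0" if "s \<in> edge_monoid n" for s
    using that
  proof (induction rule: edge_monoid_induct)
    case one
    show ?case using ring_hom_one[OF hom] by simp
  next
    case (mult s e)
    have "h (plucker_var n e) \<noteq> 0"
      using v var[OF edge_imp_segment[OF mult.hyps(2)]] mult.hyps(2) by (simp add: plucker_point_def)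
    then show ?case
      using mult.IH ring_hom_mult[OF hom edge_monoid_closed[OF mult.hyps(1)]
          plucker_var_closed[OF edge_imp_segment[OF mult.hyps(2)]]] by simp
  qed
  from L.hom_extends_to_localization[OF hom nz]
  obtain p where p: "p \<in> ring_hom (cluster_algebra n) ring_of_type_algebra"
    "p \<in> extensional (carrier (cluster_algebra n))"
    "\<And>a s. \<lbrakk>a \<in> carrier (plucker_algebra n); s \<in> edge_monoid n\<rbrakk>
       \<Longrightarrow> p (loc_frac (plucker_algebra n) (edge_monoid n) a s) = h a / h s"
    unfolding cluster_algebra_def by blast
  have "p (cluster_var n s) = v s" if "s \<in> segments n" for s
    using p(3)[OF plucker_var_closed[OF that] L.S_one] ring_hom_one[OF hom] var[OF that]
    by (simp add: cluster_var_def)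
  with p(1,2) that show ?thesis
    by (simp add: cluster_variety_def)
qed

text \<open>
  The cluster algebra is generated by the segments and the inverses of the edges, so a class of
  functions on \<open>V\<close> that is closed under sums and products contains the evaluation at every element as
  soon as it contains those at the generators.  Taking two points for \<open>V\<close> and the functions that agree on
  both gives uniqueness of points; taking the deep locus and the regular functions on the torus
  gives regularity of the inverse coordinates.
\<close>

lemma cluster_evaluation_induct:
  fixes Q :: "((cluster_element \<Rightarrow> 'k::field) \<Rightarrow> 'k) \<Rightarrow> bool"
  assumes a: "a \<in> carrier (cluster_algebra n)" and V: "V \<subseteq> cluster_variety n"
    and cong: "\<And>f g. \<lbrakk>\<And>p. p \<in> V \<Longrightarrow> f p = g p; Q f\<rbrakk> \<Longrightarrow> Q g"
    and const: "\<And>c. Q (\<lambda>_. c)"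
    and add: "\<And>f g. \<lbrakk>Q f; Q g\<rbrakk> \<Longrightarrow> Q (\<lambda>p. f p + g p)"
    and mult: "\<And>f g. \<lbrakk>Q f; Q g\<rbrakk> \<Longrightarrow> Q (\<lambda>p. f p * g p)"
    and var: "\<And>s. s \<in> segments n \<Longrightarrow> Q (\<lambda>p. p (cluster_var n s))"
    and inv: "\<And>e. e \<in> edges n \<Longrightarrow> Q (\<lambda>p. inverse (p (cluster_var n e)))"
  shows "Q (\<lambda>p. p a)"
proof -
  interpret localization_setting "plucker_algebra n" "edge_monoid n"
    by (rule localization_setting_plucker)
  have hom: "p \<in> ring_hom (localization (plucker_algebra n) (edge_monoid n)) ring_of_type_algebra"
    if "p \<in> V" for p
    using that V cluster_varietyD unfolding cluster_algebra_def by blast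
  have num: "Q (\<lambda>p. p (poly_image n P))" if "P \<in> carrier (poly_ring n)" for P
    using that
  proof (induction rule: poly_ring_induct)
    case one
    show ?case
      by (rule cong[OF _ const[of 1]]) (use V in \<open>auto simp: point_of_poly(1)\<close>)
  next
    case (var i j)
    then show ?case using assms(7)[of "(i, j)"] by (simp add: cluster_var_eq)
  next
    case (add A B)
    then show ?case
      by (intro cong[OF _ assms(5)[OF add.IH]]) (use V in \<open>auto simp: point_of_poly(2)\<close>)
  next
    case (neg A)
    then show ?case
      by (intro cong[OF _ assms(6)[OF const[of "-1"] neg.IH]]) (use V in \<open>auto simp: point_of_poly(4)\<close>)
  next
    case (mult A B)
    then show ?case
      by (intro cong[OF _ assms(6)[OF mult.IH]]) (use V in \<open>auto simp: point_of_poly(3)\<close>)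
  qed
  have den: "Q (\<lambda>p. inverse (p (loc_frac (plucker_algebra n) (edge_monoid n) s \<one>\<^bsub>plucker_algebra n\<^esub>)))"
    if "s \<in> edge_monoid n" for s
    using that
  proof (induction rule: edge_monoid_induct)
    case one
    have "p (loc_frac (plucker_algebra n) (edge_monoid n) \<one>\<^bsub>plucker_algebra n\<^esub> \<one>\<^bsub>plucker_algebra n\<^esub>) = 1"
      if "p \<in> V" for p
      using ring_hom_one[OF hom[OF that]] by (simp add: one_localization)
    then show ?case
      by (intro cong[OF _ const[of 1]]) simp
  next
    case (mult s e)
    note s = edge_monoid_closed[OF mult.hyps(1)] and e = plucker_var_closed[OF edge_imp_segment[OF mult.hyps(2)]]
    show ?case
    proof (rule cong[OF _ assms(6)[OF mult.IH assms(8)[OF mult.hyps(2)]]])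
      fix p assume p: "p \<in> V"
      show "inverse (p (loc_frac (plucker_algebra n) (edge_monoid n) s \<one>\<^bsub>plucker_algebra n\<^esub>)) *
          inverse (p (cluster_var n e)) = inverse (p (loc_frac (plucker_algebra n) (edge_monoid n)
             (s \<otimes>\<^bsub>plucker_algebra n\<^esub> plucker_var n e) \<one>\<^bsub>plucker_algebra n\<^esub>))"
        using ring_hom_mult[OF hom[OF p] loc_frac_closed[OF s S_one] loc_frac_closed[OF e S_one]] s e
        by (simp add: mult_loc_frac S_one cluster_var_def)
    qed
  qed
  from a obtain A s where A: "a = loc_frac (plucker_algebra n) (edge_monoid n) A s"
      "A \<in> carrier (plucker_algebra n)" "s \<in> edge_monoid n"
    unfolding cluster_algebra_def by (auto simp: carrier_localization)
  then obtain P where P: "A = poly_class n P" "P \<in> carrier (poly_ring n)"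
    by (auto simp: carrier_plucker_algebra)
  show ?thesis
  proof (rule cong[OF _ mult[OF num[OF P(2)] den[OF A(3)]]])
    fix p assume "p \<in> V"
    from hom_loc_frac[OF hom[OF this] A(2,3)]
    show "p (poly_image n P) * inverse (p (loc_frac (plucker_algebra n) (edge_monoid n) s \<one>\<^bsub>plucker_algebra n\<^esub>)) = p a"
      by (simp add: A(1) P(1) poly_image_def)
  qed
qed

lemma cluster_point_eqI:
  fixes p q :: "cluster_element \<Rightarrow> 'k::field"
  assumes pq: "p \<in> cluster_variety n" "q \<in> cluster_variety n"
    and eq: "\<And>s. s \<in> segments n \<Longrightarrow> p (cluster_var n s) = q (cluster_var n s)"
  shows "p = q"
proof (rule extensionalityI)
  show "p \<in> extensional (carrier (cluster_algebra n))" "q \<in> extensional (carrier (cluster_algebra n))"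
    using pq by (simp_all add: cluster_variety_def)
  fix a assume "a \<in> carrier (cluster_algebra n)"
  then show "p a = q a"
    by (rule cluster_evaluation_induct[where V = "{p, q}" and Q = "\<lambda>f. f p = f q"])
      (use pq eq edge_imp_segment in auto)
qed

section \<open>Triangulations of polygons on arbitrary vertex sets\<close>

definition chords :: "nat set \<Rightarrow> (nat \<times> nat) set" where
  "chords A = {(i, j). i \<in> A \<and> j \<in> A \<and> i < j}"

text \<open>
  Cutting off vertices leads to polygons on arbitrary finite vertex sets.  Maximality is stated one segment at
  a time, which is the form in which it is checked.
\<close>

definition triangulates :: "nat set \<Rightarrow> (nat \<times> nat) set \<Rightarrow> bool" where
  "triangulates A T \<longleftrightarrow> T \<subseteq> chords A \<and> noncrossing T \<and>
     (\<forall>s\<in>chords A. (\<forall>t\<in>T. \<not> crossing s t) \<longrightarrow> s \<in> T)"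

definition polygon_edge :: "nat set \<Rightarrow> nat \<Rightarrow> nat \<Rightarrow> bool" where
  "polygon_edge A i j \<longleftrightarrow> (i, j) \<in> chords A \<and>
     ((\<forall>x\<in>A. \<not> (i < x \<and> x < j)) \<or> (\<forall>x\<in>A. i \<le> x \<and> x \<le> j))"

lemma crossing_sym: "crossing s t \<longleftrightarrow> crossing t s"
  by (auto simp: crossing_def)

lemma triangulation_iff_triangulates: "triangulation n T \<longleftrightarrow> triangulates {1..n} T"
proof -
  have seg: "segments n = chords {1..n}"
    by (auto simp: segments_def chords_def)
  have irr: "\<not> crossing s s" for s
    by (simp add: crossing_def)
  show ?thesis
  proof
    assume T: "triangulation n T"
    have "s \<in> T" if s: "s \<in> segments n" "\<forall>t\<in>T. \<not> crossing s t" for s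
    proof -
      have "noncrossing (insert s T)"
        using T s(2) irr crossing_sym by (auto simp: triangulation_def noncrossing_def)
      then have "insert s T = T"
        using T s(1) unfolding triangulation_def by blast
      then show ?thesis by blast
    qed
    then show "triangulates {1..n} T"
      using T by (simp add: triangulates_def triangulation_def seg)
  next
    assume T: "triangulates {1..n} T"
    have "T' = T" if "T \<subseteq> T'" "T' \<subseteq> segments n" "noncrossing T'" for T'
      using T that unfolding triangulates_def noncrossing_def seg by blast
    then show "triangulation n T"
      using T by (simp add: triangulates_def triangulation_def seg)
  qed
qed

lemma polygon_edge_not_crossing:
  assumes "polygon_edge A i j" "s \<in> chords A"
  shows "\<not> crossing (i, j) s" "\<not> crossing s (i, j)"
proof -
  show "\<not> crossing (i, j) s"
    using assms by (cases s) (fastforce simp: polygon_edge_def chords_def crossing_def)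
  then show "\<not> crossing s (i, j)"
    by (simp add: crossing_sym)
qed

lemma polygon_edge_in_triangulation:
  assumes "triangulates A T" "polygon_edge A i j"
  shows "(i, j) \<in> T"
  using assms polygon_edge_not_crossing(1)[OF assms(2)]
  unfolding triangulates_def polygon_edge_def by blast

text \<open>
  A segment that avoids \<open>m\<close> and is not an edge has vertices on both sides; \<open>m\<close> lies on one of them, and
  the spoke from \<open>m\<close> to a vertex on the other side crosses the segment.
\<close>

lemma fan_triangulates:
  assumes "m \<in> A"
  shows "triangulates A {(i, j) \<in> chords A. polygon_edge A i j \<or> i = m \<or> j = m}" (is "triangulates A ?T")
  unfolding triangulates_def
proof (intro conjI ballI impI)
  show "noncrossing ?T"
    unfolding noncrossing_def
  proof (intro ballI)
    fix s t assume st: "s \<in> ?T" "t \<in> ?T"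
    obtain a b c d where ab: "s = (a, b)" "t = (c, d)"
      by (cases s, cases t)
    show "\<not> crossing s t"
    proof (cases "polygon_edge A a b \<or> polygon_edge A c d")
      case True
      then show ?thesis using st ab polygon_edge_not_crossing by auto
    next
      case False
      then have "(a = m \<or> b = m) \<and> (c = m \<or> d = m)"
        using st ab by blast
      then show ?thesis by (elim conjE disjE) (simp_all add: ab crossing_def)
    qed
  qed
  fix s assume s: "s \<in> chords A" and nc: "\<forall>t\<in>?T. \<not> crossing s t"
  obtain a b where ab: "s = (a, b)" "a \<in> A" "b \<in> A" "a < b"
    using s by (auto simp: chords_def)
  show "s \<in> ?T"
  proof (rule ccontr)
    assume "s \<notin> ?T"
    then have ne: "\<not> polygon_edge A a b" "a \<noteq> m" "b \<noteq> m"
      using s ab by auto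
    then obtain x y where x: "x \<in> A" "a < x" "x < b" and y: "y \<in> A" "y < a \<or> b < y"
      using s ab(1) by (auto simp: polygon_edge_def not_le)
    have no_cross: False if "u \<in> A" "u < m" "crossing s (u, m)" for u
      using nc that assms by (auto simp: chords_def)
    have no_cross': False if "u \<in> A" "m < u" "crossing s (m, u)" for u
      using nc that assms by (auto simp: chords_def)
    consider "a < m" "m < b" "y < a" | "a < m" "m < b" "b < y" | "m < a" | "b < m"
      using ne y(2) by linarith
    then show False
    proof cases
      case 1
      then show False using no_cross[OF y(1)] by (simp add: ab(1) crossing_def)
    next
      case 2
      then show False using no_cross'[OF y(1)] by (simp add: ab(1) crossing_def)
    next
      case 3
      then show False using no_cross'[OF x(1)] x by (simp add: ab(1) crossing_def)
    next
      case 4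
      then show False using no_cross[OF x(1)] x by (simp add: ab(1) crossing_def)
    qed
  qed
qed blast

text \<open>
  The segment \<open>(p, q)\<close> is an edge of the smaller polygon and so belongs to \<open>T\<close>; it crosses every
  segment from \<open>m\<close> to a vertex other than \<open>p\<close> and \<open>q\<close>, so nothing else can be added at \<open>m\<close>.
\<close>

lemma ear_triangulates:
  assumes pmq: "p \<in> A" "m \<in> A" "q \<in> A" "p < m" "m < q"
    and pm: "\<forall>x\<in>A. \<not> (p < x \<and> x < m)" and mq: "\<forall>x\<in>A. \<not> (m < x \<and> x < q)"
    and T: "triangulates (A - {m}) T"
  shows "triangulates A (insert (p, m) (insert (m, q) T))"
proof -
  have ch: "chords (A - {m}) \<subseteq> chords A"
    by (auto simp: chords_def)
  have edges: "polygon_edge A p m" "polygon_edge A m q"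
    using pmq pm mq by (auto simp: polygon_edge_def chords_def)
  have "polygon_edge (A - {m}) p q"
  proof -
    have "\<not> (p < x \<and> x < q)" if "x \<in> A - {m}" for x
      using that pm mq by (cases x m rule: linorder_cases) blast+
    then show ?thesis
      using pmq by (simp add: polygon_edge_def chords_def)
  qed
  then have pq: "(p, q) \<in> T"
    by (rule polygon_edge_in_triangulation[OF T])
  have Tch: "T \<subseteq> chords A"
    using T ch by (auto simp: triangulates_def)
  show ?thesis
    unfolding triangulates_def
  proof (intro conjI ballI impI)
    show sub: "insert (p, m) (insert (m, q) T) \<subseteq> chords A"
      using Tch pmq by (auto simp: chords_def)
    then show "noncrossing (insert (p, m) (insert (m, q) T))"
      using T polygon_edge_not_crossing[OF edges(1)] polygon_edge_not_crossing[OF edges(2)]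
      unfolding noncrossing_def triangulates_def by blast
    fix s assume s: "s \<in> chords A"
      and nc: "\<forall>t\<in>insert (p, m) (insert (m, q) T). \<not> crossing s t"
    obtain a b where ab: "s = (a, b)" "a \<in> A" "b \<in> A" "a < b"
      using s by (auto simp: chords_def)
    have npq: "\<not> crossing s (p, q)" using nc pq by blast
    consider "a = m" | "b = m" | "a \<noteq> m" "b \<noteq> m" by blast
    then show "s \<in> insert (p, m) (insert (m, q) T)"
    proof cases
      case 1
      have "\<not> b < q" using mq ab 1 by blast
      moreover have "\<not> q < b" using npq 1 pmq(4,5) by (simp add: ab(1) crossing_def)
      ultimately have "b = q" by simp
      then show ?thesis using ab 1 by simp
    next
      case 2
      have "\<not> p < a" using pm ab 2 by blast
      moreover have "\<not> a < p" using npq 2 pmq(4,5) by (simp add: ab(1) crossing_def)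
      ultimately have "a = p" by simp
      then show ?thesis using ab 2 by simp
    next
      case 3
      then have "s \<in> chords (A - {m})"
        using ab by (simp add: chords_def)
      then show ?thesis
        using T nc unfolding triangulates_def by blast
    qed
  qed
qed

text \<open>
  If the neighbours of every interior vertex had equal colours, the colours would alternate along
  \<open>A\<close> and only those of the two smallest vertices would occur.  Working with vertices between the
  smallest and the largest one avoids wrapping around the cyclic order.
\<close>

lemma three_colours_ear:
  fixes c :: "nat \<Rightarrow> 'c"
  assumes fin: "finite A" and three: "3 \<le> card (c ` A)"
  obtains p m q where "p \<in> A" "m \<in> A" "q \<in> A" "p < m" "m < q"
    "\<forall>x\<in>A. \<not> (p < x \<and> x < m)" "\<forall>x\<in>A. \<not> (m < x \<and> x < q)" "c p \<noteq> c q"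
proof (rule ccontr)
  note rule = that
  assume no: "\<not> thesis"
  have "3 \<le> card A"
    using three card_image_le[OF fin, of c] by linarith
  then have A: "A \<noteq> {}" by auto
  define a where "a = Min A"
  have a: "a \<in> A" "\<And>x. x \<in> A \<Longrightarrow> a \<le> x"
    using fin A by (auto simp: a_def)
  have "card (A - {a}) \<ge> 2"
    using \<open>3 \<le> card A\<close> fin a by simp
  then have A': "A - {a} \<noteq> {}" by fastforce
  define b where "b = Min (A - {a})"
  have b: "b \<in> A" "a < b" "\<And>x. x \<in> A \<Longrightarrow> x \<noteq> a \<Longrightarrow> b \<le> x"
    using Min_in[OF _ A'] fin a(2)[of b] by (auto simp: b_def)
  have pred: "\<exists>y\<in>A. y < x \<and> (\<forall>w\<in>A. \<not> (y < w \<and> w < x))" if "x \<in> A" "x \<noteq> a" for x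
  proof -
    let ?B = "{w \<in> A. w < x}"
    have B: "finite ?B" "?B \<noteq> {}"
      using fin a that by (auto intro!: exI[of _ a] simp: order_le_neq_trans)
    have "Max ?B \<in> ?B" by (rule Max_in[OF B])
    moreover have "\<forall>w\<in>A. \<not> (Max ?B < w \<and> w < x)"
      using Max_ge[OF B(1)] by (auto simp: not_less)
    ultimately show ?thesis by blast
  qed
  have "x \<in> A \<longrightarrow> c x \<in> {c a, c b}" for x
  proof (induction x rule: less_induct)
    case (less x)
    show ?case
    proof (cases "x \<in> A \<and> x \<noteq> a \<and> x \<noteq> b")
      case True
      then obtain y where y: "y \<in> A" "y < x" "\<forall>w\<in>A. \<not> (y < w \<and> w < x)"
        using pred by blast
      have "b < x" using b(3) True by force
      then have "y \<noteq> a" using y(3) b(1,2) by blast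
      then obtain z where z: "z \<in> A" "z < y" "\<forall>w\<in>A. \<not> (z < w \<and> w < y)"
        using pred y(1) by blast
      have "c z = c x"
        using no rule[OF z(1) y(1) _ z(2) y(2) z(3) y(3)] True by blast
      then show ?thesis
        using less.IH[of z] z(1,2) y(2) by simp
    qed auto
  qed
  then have "c ` A \<subseteq> {c a, c b}" by blast
  then have "card (c ` A) \<le> card {c a, c b}" by (intro card_mono) auto
  also have "\<dots> \<le> 2" by (simp add: card_insert_if)
  finally show False using three by simp
qed

text \<open>
  Induction on the number of vertices, with an ear \<open>m\<close> between differently coloured \<open>p\<close> and \<open>q\<close>.  If no
  other vertex has the colour of \<open>m\<close>, then all spokes of the fan at \<open>m\<close> are bichromatic.  Otherwise all
  colours survive when \<open>m\<close> is cut off, and the new edge \<open>(p, q)\<close> is bichromatic by the choice of \<open>m\<close>.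
\<close>

lemma bichromatic_triangulation:
  fixes c :: "nat \<Rightarrow> 'c"
  assumes "finite A" and "3 \<le> card (c ` A)"
    and "\<And>i j. polygon_edge A i j \<Longrightarrow> c i \<noteq> c j"
  shows "\<exists>T. triangulates A T \<and> (\<forall>(i, j)\<in>T. c i \<noteq> c j)"
  using assms
proof (induction "card A" arbitrary: A rule: less_induct)
  case less
  obtain p m q where ear: "p \<in> A" "m \<in> A" "q \<in> A" "p < m" "m < q"
    "\<forall>x\<in>A. \<not> (p < x \<and> x < m)" "\<forall>x\<in>A. \<not> (m < x \<and> x < q)" and pq: "c p \<noteq> c q"
    using three_colours_ear[OF less.prems(1,2)] by metis
  show ?case
  proof (cases "\<forall>x\<in>A. c x = c m \<longrightarrow> x = m")
    case True
    have "c i \<noteq> c j"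
      if "(i, j) \<in> {(i, j) \<in> chords A. polygon_edge A i j \<or> i = m \<or> j = m}" for i j
      using that True less.prems(3)[of i j] by (fastforce simp: chords_def)
    then show ?thesis
      using fan_triangulates[OF ear(2)] by blast
  next
    case False
    let ?B = "A - {m}"
    from False obtain m' where "m' \<in> ?B" "c m' = c m" by blast
    then have "c m \<in> c ` ?B" by (metis imageI)
    then have "c ` ?B = c ` A" using ear(2) by blast
    moreover have "c i \<noteq> c j" if e: "polygon_edge ?B i j" for i j
    proof (cases "polygon_edge A i j")
      case True
      then show ?thesis by (rule less.prems(3))
    next
      case False
      have ij: "i \<in> A" "j \<in> A" "i \<noteq> m" "j \<noteq> m" "i < j"
        using e by (auto simp: polygon_edge_def chords_def)
      have gap: "\<forall>x\<in>?B. \<not> (i < x \<and> x < j)"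
      proof (rule ccontr)
        assume "\<not> ?thesis"
        then have all: "\<forall>x\<in>?B. i \<le> x \<and> x \<le> j"
          using e by (auto simp: polygon_edge_def)
        then have "i \<le> p" "q \<le> j" using ear by auto
        then have "\<forall>x\<in>A. i \<le> x \<and> x \<le> j"
          using all ear(4,5) by force
        with False ij show False by (auto simp: polygon_edge_def chords_def)
      qed
      have im: "i < m" "m < j"
        using False gap ij ear(2) by (auto simp: polygon_edge_def chords_def)
      have "i = p" "j = q"
        using gap im ear ij by (metis DiffI less_imp_neq linorder_neqE_nat order.strict_trans singletonD)+
      then show ?thesis using pq by simp
    qed
    moreover have "card ?B < card A"
      using less.prems(1) ear(2) by (rule card_Diff1_less)
    ultimately obtain T where T: "triangulates ?B T" "\<forall>(i, j)\<in>T. c i \<noteq> c j"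
      using less.hyps[of ?B] less.prems(1,2) by auto
    have "c p \<noteq> c m" "c m \<noteq> c q"
      using ear by (auto intro!: less.prems(3) simp: polygon_edge_def chords_def)
    then show ?thesis
      using ear_triangulates[OF ear T(1)] T(2) by blast
  qed
qed

text \<open>
  Let \<open>(1, k, n)\<close> be the triangle on the edge \<open>(1, n)\<close>.  As \<open>n - 1\<close> is odd, one of \<open>k - 1\<close> and
  \<open>n - k\<close> is even.  The vertex \<open>k\<close> is the last neighbour of \<open>1\<close> before \<open>n\<close>: a segment of the
  triangulation that crosses \<open>(k, n)\<close> would start strictly between \<open>1\<close> and \<open>k\<close> and so cross \<open>(1, k)\<close>.
\<close>

lemma same_parity_diagonal_in_triangulation:
  assumes n: "even n" "n \<ge> 4" and T: "triangulation n T"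
  obtains i j where "(i, j) \<in> T \<inter> diagonals n" "i mod 2 = j mod 2"
proof -
  have T': "triangulates {1..n} T"
    using T by (simp add: triangulation_iff_triangulates)
  have edge: "(1, 2) \<in> T"
    by (rule polygon_edge_in_triangulation[OF T']) (use n in \<open>auto simp: polygon_edge_def chords_def\<close>)
  define k where "k = Max {j. j < n \<and> (1, j) \<in> T}"
  have fin: "finite {j. j < n \<and> (1, j) \<in> T}" by simp
  have ne: "{j. j < n \<and> (1, j) \<in> T} \<noteq> {}" using edge n(2) by (auto intro!: exI[of _ 2])
  have k: "k < n" "(1, k) \<in> T" and max: "\<And>j. j < n \<Longrightarrow> (1, j) \<in> T \<Longrightarrow> j \<le> k"
    using Max_in[OF fin ne] Max_ge[OF fin] by (auto simp: k_def)
  have Tch: "T \<subseteq> chords {1..n}" and nc: "noncrossing T"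
    using T' by (simp_all add: triangulates_def)
  have k1: "1 < k" using k(2) Tch by (auto simp: chords_def)
  have "\<not> crossing (k, n) (a, b)" if ab: "(a, b) \<in> T" for a b
  proof
    assume cr: "crossing (k, n) (a, b)"
    have "1 \<le> a" "b \<le> n" using ab Tch by (auto simp: chords_def)
    with cr have *: "a < k" "k < b" "b < n" by (auto simp: crossing_def)
    with max[of b] ab have "a \<noteq> 1" by auto
    with * \<open>1 \<le> a\<close> have "crossing (1, k) (a, b)" by (auto simp: crossing_def)
    then show False using nc k(2) ab by (auto simp: noncrossing_def)
  qed
  moreover have "(k, n) \<in> chords {1..n}"
    using k k1 by (auto simp: chords_def)
  ultimately have kn: "(k, n) \<in> T"
    using T' by (force simp: triangulates_def)
  have diag: "(i, j) \<in> diagonals n" if "(i, j) \<in> T" "i mod 2 = j mod 2" for i j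
  proof -
    have "i + 1 \<noteq> j" using that(2) by presburger
    moreover have "\<not> (i = 1 \<and> j = n)" using that(2) n(1) by auto
    ultimately show ?thesis
      using that(1) Tch by (auto simp: diagonals_def edges_def segments_def chords_def)
  qed
  show ?thesis
  proof (cases "even k")
    case True
    then show ?thesis
      using that kn diag n(1) by (metis IntI even_iff_mod_2_eq_zero)
  next
    case False
    then show ?thesis
      using that[of 1 k] k(2) diag[of 1 k] by (simp add: odd_iff_mod_2_eq_one)
  qed
qed

section \<open>Deep points have two alternating colours\<close>

definition deep_vector :: "nat \<Rightarrow> (nat \<times> nat \<Rightarrow> 'k::field) \<Rightarrow> bool" where
  "deep_vector n v \<longleftrightarrow> plucker_point n v \<and>
     (\<forall>T. triangulation n T \<longrightarrow> (\<exists>s\<in>T \<inter> diagonals n. v s = 0))"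

lemma deep_locus_iff:
  "p \<in> deep_locus n \<longleftrightarrow> p \<in> cluster_variety n \<and> deep_vector n (\<lambda>s. p (cluster_var n s))"
  using plucker_point_of_cluster_variety by (auto simp: deep_locus_def deep_vector_def)

text \<open>
  The colour of \<open>i\<close> is the point of the projective line with homogeneous coordinates \<open>(a i, b i)\<close>,
  where \<open>None\<close> is the point at infinity.
\<close>

lemma plucker_colouring:
  fixes v :: "nat \<times> nat \<Rightarrow> 'k::field"
  assumes n: "n \<ge> 3" and v: "plucker_point n v"
  obtains c :: "nat \<Rightarrow> 'k option" where "\<And>i j. (i, j) \<in> segments n \<Longrightarrow> v (i, j) = 0 \<longleftrightarrow> c i = c j"
proof -
  have edge: "v (i, Suc i) \<noteq> 0" if "1 \<le> i" "i < n" for i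
    using v that by (auto simp: plucker_point_def edges_def segments_def)
  have v12: "v (1, 2) \<noteq> 0" using edge[of 1] n by (simp add: numeral_2_eq_2)
  \<comment> \<open>The values at \<open>1\<close> and \<open>2\<close> continue \<open>x\<^sub>1\<^sub>i\<close> and \<open>x\<^sub>2\<^sub>i\<close> antisymmetrically.\<close>
  define a where "a i = (if i = 1 then 0 else v (1, i))" for i
  define b where "b i = (if i = 1 then - v (1, 2) else if i = 2 then 0 else v (2, i))" for i
  have det: "v (1, 2) * v (i, j) = a i * b j - a j * b i" if "1 \<le> i" "i < j" "j \<le> n" for i j
  proof -
    consider "i = 1" | "i = 2" | "2 < i" using \<open>1 \<le> i\<close> by linarith
    then show ?thesis
    proof cases
      case 3
      have "v (1, i) * v (2, j) = v (1, 2) * v (i, j) + v (1, j) * v (2, i)"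
        using v that 3 unfolding plucker_point_def by (metis one_less_numeral_iff order.refl semiring_norm(76))
      then show ?thesis using 3 that by (simp add: a_def b_def algebra_simps)
    qed (use that in \<open>simp_all add: a_def b_def\<close>)
  qed
  \<comment> \<open>Each vertex lies on an edge \<open>(k, k + 1)\<close>, whose determinant is nonzero.\<close>
  have nz: "a i \<noteq> 0 \<or> b i \<noteq> 0" if i: "1 \<le> i" "i \<le> n" for i
  proof (cases "i < n")
    case True
    then have "a i * b (Suc i) - a (Suc i) * b i \<noteq> 0"
      using edge[of i] v12 i by (simp flip: det)
    then show ?thesis by auto
  next
    case False
    then have "a (i - 1) * b i - a i * b (i - 1) \<noteq> 0"
      using edge[of "i - 1"] v12 i n by (simp flip: det)
    then show ?thesis by auto
  qed
  define c where "c i = (if b i = 0 then None else Some (a i / b i))" for i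
  have "v (i, j) = 0 \<longleftrightarrow> c i = c j" if "(i, j) \<in> segments n" for i j
  proof -
    have ij: "1 \<le> i" "i < j" "j \<le> n" using that by (auto simp: segments_def)
    have "v (i, j) = 0 \<longleftrightarrow> a i * b j - a j * b i = 0"
      using v12 by (simp flip: det[OF ij])
    also have "\<dots> \<longleftrightarrow> c i = c j"
      using nz[of i] nz[of j] ij by (auto simp: c_def field_simps)
    finally show ?thesis .
  qed
  then show ?thesis by (rule that)
qed

text \<open>
  With three colours there would be a triangulation without zeros.  Two colours must alternate
  because neighbours differ, and the edge \<open>(1, n)\<close> forces \<open>n\<close> to be even.
\<close>

lemma deep_vector_zero_iff:
  fixes v :: "nat \<times> nat \<Rightarrow> 'k::field"
  assumes n: "n \<ge> 3" and v: "deep_vector n v"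
  shows "even n" and "(i, j) \<in> segments n \<Longrightarrow> v (i, j) = 0 \<longleftrightarrow> i mod 2 = j mod 2"
proof -
  have pv: "plucker_point n v" using v by (simp add: deep_vector_def)
  obtain c :: "nat \<Rightarrow> 'k option"
    where c: "\<And>i j. (i, j) \<in> segments n \<Longrightarrow> v (i, j) = 0 \<longleftrightarrow> c i = c j"
    using plucker_colouring[OF n pv] by blast
  have edge_ne: "c i \<noteq> c j" if "(i, j) \<in> edges n" for i j
    using that pv c edge_imp_segment[OF that] by (auto simp: plucker_point_def)
  have "c i \<noteq> c j" if "polygon_edge {1..n} i j" for i j
  proof (rule edge_ne)
    have ij: "1 \<le> i" "i < j" "j \<le> n" using that by (auto simp: polygon_edge_def chords_def)
    have "j = i + 1 \<or> (i = 1 \<and> j = n)"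
      using that unfolding polygon_edge_def
    proof (elim conjE disjE)
      assume "\<forall>x\<in>{1..n}. \<not> (i < x \<and> x < j)"
      from bspec[OF this, of "i + 1"] show ?thesis using ij by auto
    next
      assume *: "\<forall>x\<in>{1..n}. i \<le> x \<and> x \<le> j"
      from bspec[OF *, of 1] bspec[OF *, of n] show ?thesis using ij by auto
    qed
    then show "(i, j) \<in> edges n"
      using ij by (auto simp: edges_def segments_def)
  qed
  moreover have "\<not> (\<exists>T. triangulates {1..n} T \<and> (\<forall>(i, j)\<in>T. c i \<noteq> c j))"
  proof safe
    fix T assume T: "triangulates {1..n} T" and ne: "\<forall>(i, j)\<in>T. c i \<noteq> c j"
    then obtain s where "s \<in> T \<inter> diagonals n" "v s = 0"
      using v by (auto simp: deep_vector_def triangulation_iff_triangulates)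
    then show False
      using ne c by (cases s) (auto simp: diagonals_def)
  qed
  ultimately have "card (c ` {1..n}) < 3"
    using bichromatic_triangulation[of "{1..n}" c] by fastforce
  moreover have c12: "c 1 \<noteq> c 2"
    using n by (intro edge_ne) (auto simp: edges_def segments_def)
  moreover have "card {c 1, c 2} \<le> card (c ` {1..n})"
    using n by (intro card_mono) auto
  ultimately have two: "c ` {1..n} = {c 1, c 2}"
    using n by (intro card_subset_eq[symmetric]) auto
  have colour: "c i = (if odd i then c 1 else c 2)" if "1 \<le> i" "i \<le> n" for i
    using that
  proof (induction i rule: nat_induct_at_least)
    case (Suc i)
    have "c i \<noteq> c (Suc i)"
      using Suc by (intro edge_ne) (auto simp: edges_def segments_def)
    moreover have "c (Suc i) \<in> {c 1, c 2}"
      using Suc.prems by (subst two[symmetric]) auto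
    ultimately show ?case
      using Suc by (auto split: if_splits)
  qed simp
  have "c 1 \<noteq> c n"
    using n by (intro edge_ne) (auto simp: edges_def segments_def)
  then show "even n" using colour[of n] n by (auto split: if_splits)
  show "v (i, j) = 0 \<longleftrightarrow> i mod 2 = j mod 2" if "(i, j) \<in> segments n"
    unfolding c[OF that] using that colour[of i] colour[of j] c12
    by (auto simp: segments_def mod_2_eq_odd)
qed

section \<open>The values of a deep point\<close>

text \<open>
  The value of the segment \<open>(i, i + 2 m + 1)\<close> at a deep point, as a function of the edges on the
  boundary path between its ends.
\<close>

definition path_ratio :: "(nat \<times> nat \<Rightarrow> 'k::field) \<Rightarrow> nat \<Rightarrow> nat \<Rightarrow> 'k" where
  "path_ratio w i m = (- 1) ^ m *
     ((\<Prod>t = 0..m. w (i + 2 * t, i + 2 * t + 1)) / (\<Prod>t = 1..m. w (i + 2 * t - 1, i + 2 * t)))"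

lemma path_ratio_cong:
  assumes "\<And>k. \<lbrakk>i \<le> k; k \<le> i + 2 * m\<rbrakk> \<Longrightarrow> w (k, k + 1) = w' (k, k + 1)"
  shows "path_ratio w i m = path_ratio w' i m"
proof -
  have "w (i + 2 * t - 1, i + 2 * t) = w' (i + 2 * t - 1, i + 2 * t)" if "t \<in> {1..m}" for t
    using assms[of "i + 2 * t - 1"] that by auto
  moreover have "w (i + 2 * t, i + 2 * t + 1) = w' (i + 2 * t, i + 2 * t + 1)" if "t \<in> {0..m}" for t
    using assms[of "i + 2 * t"] that by auto
  ultimately show ?thesis
    unfolding path_ratio_def by (metis (no_types, lifting) prod.cong)
qed

lemma path_ratio_nonzero:
  assumes "\<And>k. \<lbrakk>i \<le> k; k \<le> i + 2 * m\<rbrakk> \<Longrightarrow> w (k, k + 1) \<noteq> 0"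
  shows "path_ratio w i m \<noteq> 0"
proof -
  have "w (i + 2 * t - 1, i + 2 * t) \<noteq> 0" if "t \<in> {1..m}" for t
  proof -
    have "i \<le> i + 2 * t - 1" "i + 2 * t - 1 \<le> i + 2 * m" using that by auto
    from assms[OF this] show ?thesis using that by simp
  qed
  moreover have "w (i + 2 * t, i + 2 * t + 1) \<noteq> 0" if "t \<in> {0..m}" for t
    using assms[of "i + 2 * t"] that by auto
  ultimately show ?thesis
    by (simp add: path_ratio_def)
qed

text \<open>
  An edge of the path from \<open>1\<close> to \<open>2 m + 2\<close> occurs exactly once in the quotient, in the numerator or in the
  denominator according to its parity.  So its value can be solved for.
\<close>

lemma path_ratio_update:
  fixes w :: "nat \<times> nat \<Rightarrow> 'k::field"
  assumes k: "1 \<le> k" "k \<le> 2 * m + 1"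
  shows "path_ratio (w((k, k + 1) := c)) 1 m
    = path_ratio (w((k, k + 1) := 1)) 1 m * (if odd k then c else inverse c)"
proof -
  let ?w = "w((k, k + 1) := 1)"
  have w: "(w((k, k + 1) := c)) s = ?w s * (if s = (k, k + 1) then c else 1)" for s
    by simp
  have num: "(\<Prod>t = 0..m. if (1 + 2 * t, 1 + 2 * t + 1) = (k, k + 1) then c else 1) = (if odd k then c else 1)"
  proof (cases "odd k")
    case True
    then obtain t0 where t0: "k = 2 * t0 + 1" by (rule oddE)
    have "(\<Prod>t = 0..m. if (1 + 2 * t, 1 + 2 * t + 1) = (k, k + 1) then c else 1)
      = (\<Prod>t = 0..m. if t = t0 then c else 1)"
      by (intro prod.cong) (auto simp: t0)
    then show ?thesis using k True t0 by (simp add: prod.delta)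
  next
    case False
    then have "(1 + 2 * t, 1 + 2 * t + 1) \<noteq> (k, k + 1)" for t by auto
    then show ?thesis using False by simp
  qed
  have den: "(\<Prod>t = 1..m. if (1 + 2 * t - 1, 1 + 2 * t) = (k, k + 1) then c else 1) = (if odd k then 1 else c)"
  proof (cases "odd k")
    case True
    then have "(1 + 2 * t - 1, 1 + 2 * t) \<noteq> (k, k + 1)" for t by auto
    then show ?thesis using True by simp
  next
    case False
    then obtain t0 where t0: "k = 2 * t0" by (auto elim: evenE)
    have "(\<Prod>t = 1..m. if (1 + 2 * t - 1, 1 + 2 * t) = (k, k + 1) then c else 1)
      = (\<Prod>t = 1..m. if t = t0 then c else 1)"
      by (intro prod.cong) (auto simp: t0)
    then show ?thesis using k False t0 by (simp add: prod.delta)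
  qed
  show ?thesis
    unfolding path_ratio_def w prod.distrib num den by (simp add: field_simps)
qed

text \<open>
  In the Pluecker relation on \<open>i < j < j + 1 < j + 2\<close> with \<open>j - i\<close> odd, the segments \<open>(i, j + 1)\<close> and
  \<open>(j, j + 2)\<close> join vertices of the same parity and vanish, which expresses \<open>v (i, j + 2)\<close> by \<open>v (i, j)\<close>.
\<close>

lemma deep_vector_value:
  fixes v :: "nat \<times> nat \<Rightarrow> 'k::field"
  assumes n: "n \<ge> 3" and v: "deep_vector n v" and i: "1 \<le> i" "i + 2 * m + 1 \<le> n"
  shows "v (i, i + 2 * m + 1) = path_ratio v i m"
  using i(2)
proof (induction m)
  case 0
  then show ?case by (simp add: path_ratio_def)
next
  case (Suc m)
  define j where "j = i + 2 * m + 1"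
  have jn: "j + 2 \<le> n" and ij: "i < j" using Suc.prems by (simp_all add: j_def)
  have "v (i, j + 1) * v (j, j + 2) = v (i, j) * v (j + 1, j + 2) + v (i, j + 2) * v (j, j + 1)"
    using v i(1) ij jn unfolding deep_vector_def plucker_point_def by simp
  moreover have "v (i, j + 1) = 0"
    using deep_vector_zero_iff(2)[OF n v, of i "j + 1"] i(1) jn by (simp add: segments_def j_def)
  moreover have "v (j, j + 1) \<noteq> 0"
    using v i(1) ij jn by (auto simp: deep_vector_def plucker_point_def edges_def segments_def)
  ultimately have "v (i, j + 2) = - (v (i, j) * v (j + 1, j + 2)) / v (j, j + 1)"
    by (simp add: field_simps eq_neg_iff_add_eq_0)
  also have "v (i, j) = path_ratio v i m"
    using Suc by (simp add: j_def)
  also have "- (path_ratio v i m * v (j + 1, j + 2)) / v (j, j + 1) = path_ratio v i (Suc m)"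
    by (simp add: path_ratio_def j_def)
  finally show ?case by (simp add: j_def)
qed

definition balanced :: "nat \<Rightarrow> (nat \<times> nat \<Rightarrow> 'k::field) \<Rightarrow> bool" where
  "balanced n w \<longleftrightarrow> (\<Prod>t = 1..n div 2. w (2 * t - 1, 2 * t)) /
     (w (1, n) * (\<Prod>t = 1..<n div 2. w (2 * t, 2 * t + 1))) = (- 1) ^ ((n + 2) div 2)"

text \<open>
  The condition on the edges says that the edge \<open>(1, n)\<close> has the value that a deep point takes there.
\<close>

lemma balanced_iff:
  fixes w :: "nat \<times> nat \<Rightarrow> 'k::field"
  assumes n: "n = 2 * m + 2" and w: "\<And>k. \<lbrakk>1 \<le> k; k < n\<rbrakk> \<Longrightarrow> w (k, k + 1) \<noteq> 0" "w (1, n) \<noteq> 0"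
  shows "balanced n w \<longleftrightarrow> w (1, n) = path_ratio w 1 m"
proof -
  define A where "A = (\<Prod>t = 0..m. w (1 + 2 * t, 1 + 2 * t + 1))"
  define B where "B = (\<Prod>t = 1..m. w (1 + 2 * t - 1, 1 + 2 * t))"
  have "n div 2 = Suc m" by (simp add: n)
  then have "(\<Prod>t = 1..n div 2. w (2 * t - 1, 2 * t)) = (\<Prod>t = Suc 0..Suc m. w (2 * t - 1, 2 * t))"
    by (simp only: One_nat_def)
  also have "\<dots> = A"
    unfolding A_def prod.shift_bounds_cl_Suc_ivl by simp
  finally have "(\<Prod>t = 1..n div 2. w (2 * t - 1, 2 * t)) = A" .
  moreover have "(\<Prod>t = 1..<n div 2. w (2 * t, 2 * t + 1)) = B"
    unfolding B_def by (intro prod.cong) (auto simp: n)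
  moreover have "B \<noteq> 0"
    unfolding B_def using w(1) by (auto simp: n)
  moreover have "(n + 2) div 2 = m + 2" by (simp add: n)
  ultimately have "balanced n w \<longleftrightarrow> A = (- 1) ^ m * (w (1, n) * B)"
    using w(2) by (simp add: balanced_def divide_eq_eq)
  also have "\<dots> \<longleftrightarrow> w (1, n) = (- 1) ^ m * (A / B)"
    using \<open>B \<noteq> 0\<close> by (cases "even m") (auto simp: field_simps)
  finally show ?thesis by (simp add: path_ratio_def A_def B_def)
qed

text \<open>
  Lengths of vectors that lie alternately on the two coordinate axes, chosen so that the determinant of
  the vectors of \<open>i\<close> and \<open>i + 1\<close> is \<open>f i\<close>.  The determinant of a vector on the second axis and one on the
  first has a negative sign.  Vertices are numbered from \<open>1\<close>, where the length is normalized to \<open>1\<close>; the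
  value at \<open>0\<close> is a placeholder.
\<close>

primrec zigzag :: "(nat \<Rightarrow> 'k::field) \<Rightarrow> nat \<Rightarrow> 'k" where
  "zigzag f 0 = 1"
| "zigzag f (Suc i) = (if i = 0 then 1 else if odd i then f i / zigzag f i else - f i / zigzag f i)"

text \<open>
  The Pluecker relation is an identity between determinants of plane vectors, and segments between
  vertices of the same parity vanish since their vectors are parallel.
\<close>

lemma deep_vector_exists:
  fixes f :: "nat \<Rightarrow> 'k::field"
  assumes n: "even n" "n \<ge> 4" and f: "\<And>i. \<lbrakk>1 \<le> i; i < n\<rbrakk> \<Longrightarrow> f i \<noteq> 0"
  obtains v where "deep_vector n v" "\<And>i. \<lbrakk>1 \<le> i; i < n\<rbrakk> \<Longrightarrow> v (i, i + 1) = f i"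
proof -
  define x where "x i = (if odd i then zigzag f i else 0)" for i
  define y where "y i = (if odd i then 0 else zigzag f i)" for i
  define v where "v s = x (fst s) * y (snd s) - x (snd s) * y (fst s)" for s
  have nz: "zigzag f i \<noteq> 0" if "i \<le> n" for i
    using that f by (induction i) auto
  have edge: "v (i, i + 1) = f i" if "1 \<le> i" "i < n" for i
    using nz[of i] that by (auto simp: v_def x_def y_def)
  have "plucker_point n v"
    unfolding plucker_point_def
  proof (intro conjI allI impI ballI)
    show "v (i, k) * v (j, l) = v (i, j) * v (k, l) + v (i, l) * v (j, k)" for i j k l
      by (simp add: v_def algebra_simps)
    fix e assume "e \<in> edges n"
    then consider i where "e = (i, i + 1)" "1 \<le> i" "i < n" | "e = (1, n)"
      by (auto simp: edges_def segments_def)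
    then show "v e \<noteq> 0"
    proof cases
      case 1
      then show ?thesis using edge f by simp
    next
      case 2
      then show ?thesis using n nz[of 1] nz[of n] by (simp add: v_def x_def y_def)
    qed
  qed
  moreover have "\<exists>s\<in>T \<inter> diagonals n. v s = 0" if T: "triangulation n T" for T
  proof -
    obtain i j where "(i, j) \<in> T \<inter> diagonals n" "i mod 2 = j mod 2"
      using same_parity_diagonal_in_triangulation[OF n T] .
    moreover from this have "v (i, j) = 0"
      by (auto simp: v_def x_def y_def mod_2_eq_odd split: if_splits)
    ultimately show ?thesis by blast
  qed
  ultimately have "deep_vector n v"
    by (simp add: deep_vector_def)
  with edge that show ?thesis by blast
qed

lemma deep_point_exists:
  fixes f :: "nat \<Rightarrow> 'k::field"
  assumes n: "even n" "n \<ge> 4" and f: "\<And>i. \<lbrakk>1 \<le> i; i < n\<rbrakk> \<Longrightarrow> f i \<noteq> 0"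
  obtains p where "p \<in> deep_locus n" "\<And>i. \<lbrakk>1 \<le> i; i < n\<rbrakk> \<Longrightarrow> p (cluster_var n (i, i + 1)) = f i"
proof -
  obtain v where v: "deep_vector n v" "\<And>i. \<lbrakk>1 \<le> i; i < n\<rbrakk> \<Longrightarrow> v (i, i + 1) = f i"
    using deep_vector_exists[OF n, of f] f by blast
  then obtain p where p: "p \<in> cluster_variety n" "\<And>s. s \<in> segments n \<Longrightarrow> p (cluster_var n s) = v s"
    using cluster_variety_of_plucker_point[of n v] by (auto simp: deep_vector_def)
  have "p \<in> deep_locus n"
    using p v(1) by (force simp: deep_locus_def deep_vector_def diagonals_def)
  moreover have "p (cluster_var n (i, i + 1)) = f i" if "1 \<le> i" "i < n" for i
    using p(2)[of "(i, i + 1)"] v(2) that by (simp add: segments_def)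
  ultimately show ?thesis using that by blast
qed

lemma segment_cases:
  assumes "(i, j) \<in> segments n"
  obtains "i mod 2 = j mod 2" | m where "i mod 2 \<noteq> j mod 2" "j = i + 2 * m + 1" "(j - i - 1) div 2 = m"
proof (cases "i mod 2 = j mod 2")
  case False
  have "i < j" using assms by (simp add: segments_def)
  with False have "even (j - i - 1)" by presburger
  then obtain m where "j - i - 1 = 2 * m" by (rule evenE)
  with \<open>i < j\<close> have "j = i + 2 * m + 1" by simp
  with False that show ?thesis by simp
qed

lemma deep_point_value:
  fixes p :: "cluster_element \<Rightarrow> 'k::field"
  assumes n: "n \<ge> 3" and p: "p \<in> deep_locus n" and ij: "(i, j) \<in> segments n"
    and w: "\<And>k. \<lbrakk>1 \<le> k; k < n\<rbrakk> \<Longrightarrow> p (cluster_var n (k, k + 1)) = w (k, k + 1)"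
  shows "p (cluster_var n (i, j)) =
    (if i mod 2 \<noteq> j mod 2 then path_ratio w i ((j - i - 1) div 2) else 0)"
proof -
  have v: "deep_vector n (\<lambda>s. p (cluster_var n s))"
    using p by (simp add: deep_locus_iff)
  show ?thesis
    using ij
  proof (cases rule: segment_cases)
    case 1
    then show ?thesis using deep_vector_zero_iff(2)[OF n v ij] by simp
  next
    case (2 m)
    have "1 \<le> i" "j \<le> n" using ij by (auto simp: segments_def)
    then have "p (cluster_var n (i, j)) = path_ratio (\<lambda>s. p (cluster_var n s)) i m"
      using deep_vector_value[OF n v, of i m] 2 by simp
    also have "\<dots> = path_ratio w i m"
      using \<open>1 \<le> i\<close> \<open>j \<le> n\<close> 2(2) by (intro path_ratio_cong w) auto
    finally show ?thesis using 2 by simp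
  qed
qed

lemma deep_point_eqI:
  fixes p q :: "cluster_element \<Rightarrow> 'k::field"
  assumes n: "n \<ge> 3" and p: "p \<in> deep_locus n" and q: "q \<in> deep_locus n"
    and eq: "\<And>k. \<lbrakk>1 \<le> k; k < n\<rbrakk> \<Longrightarrow> p (cluster_var n (k, k + 1)) = q (cluster_var n (k, k + 1))"
  shows "p = q"
proof (rule cluster_point_eqI)
  show "p \<in> cluster_variety n" "q \<in> cluster_variety n"
    using p q by (simp_all add: deep_locus_iff)
  fix s assume s: "s \<in> segments n"
  obtain i j where ij: "s = (i, j)" by (cases s)
  show "p (cluster_var n s) = q (cluster_var n s)"
    using deep_point_value[OF n p, of i j "\<lambda>s. q (cluster_var n s)"] deep_point_value[OF n q, of i j "\<lambda>s. q (cluster_var n s)"] s eq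
    by (simp add: ij)
qed

section \<open>The deep locus is a torus\<close>

text \<open>
  The balance equation is of degree \<open>1\<close> or \<open>-1\<close> in each edge, so it determines the value on one edge from
  the others.
\<close>

lemma missing_edge_value:
  fixes w :: "nat \<times> nat \<Rightarrow> 'k::field"
  assumes n: "n = 2 * m + 2" "m \<ge> 1" and e: "e \<in> edges n"
    and w: "\<And>e'. e' \<in> edges n - {e} \<Longrightarrow> w e' \<noteq> 0"
  shows "\<exists>!c. c \<noteq> 0 \<and> (w(e := c)) (1, n) = path_ratio (w(e := c)) 1 m"
proof (cases "e = (1, n)")
  case True
  have "path_ratio (w(e := c)) 1 m = path_ratio w 1 m" for c
    using n True by (intro path_ratio_cong) auto
  moreover have "path_ratio w 1 m \<noteq> 0"
    using n True by (intro path_ratio_nonzero w) (auto simp: edges_def segments_def)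
  ultimately show ?thesis
    using True by (intro ex1I[of _ "path_ratio w 1 m"]) auto
next
  case False
  then obtain k where k: "e = (k, k + 1)" "1 \<le> k" "k < n"
    using e by (auto simp: edges_def segments_def)
  define u where "u = path_ratio (w(e := 1)) 1 m"
  have u: "u \<noteq> 0"
    unfolding u_def using n by (intro path_ratio_nonzero) (use w in \<open>auto simp: edges_def segments_def\<close>)
  have w1: "w (1, n) \<noteq> 0"
    using False n by (intro w) (auto simp: edges_def segments_def)
  have "(w(e := c)) (1, n) = path_ratio (w(e := c)) 1 m
      \<longleftrightarrow> w (1, n) = u * (if odd k then c else inverse c)" for c
  proof -
    have "(w(e := c)) (1, n) = w (1, n)" using False by auto
    moreover have "path_ratio (w(e := c)) 1 m = u * (if odd k then c else inverse c)"
      using path_ratio_update[of k m w c] k(2,3) n(1) by (simp only: u_def k(1))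
    ultimately show ?thesis by (simp only:)
  qed
  then show ?thesis
    using u w1
    by (intro ex1I[of _ "if odd k then w (1, n) / u else u / w (1, n)"]) (auto simp: field_simps)
qed

lemma closing_edge_value:
  fixes p :: "cluster_element \<Rightarrow> 'k::field"
  assumes m: "n = 2 * m + 2" "m \<ge> 1" and p: "p \<in> deep_locus n"
    and u: "\<And>i. \<lbrakk>1 \<le> i; i < n\<rbrakk> \<Longrightarrow> p (cluster_var n (i, i + 1)) = u (i, i + 1)"
  shows "p (cluster_var n (1, n)) = path_ratio u 1 m"
proof -
  have "n \<ge> 3" "(1, n) \<in> segments n" "(n - 1 - 1) div 2 = m" "(1::nat) mod 2 \<noteq> n mod 2"
    using m by (auto simp: segments_def)
  then show ?thesis
    using deep_point_value[OF _ p, of 1 n u] u by simp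
qed

text \<open>
  The value \<open>c\<close> on the missing edge is forced by the balance equation.  The deep point with the
  resulting values on \<open>(1, 2), \<dots>, (n - 1, n)\<close> then has the right value on \<open>(1, n)\<close> as well.
\<close>

lemma deep_point_missing_edge:
  fixes w :: "nat \<times> nat \<Rightarrow> 'k::field"
  assumes n: "even n" "n \<ge> 4" and e: "e \<in> edges n"
    and w: "\<And>e'. e' \<in> edges n - {e} \<Longrightarrow> w e' \<noteq> 0"
  shows "\<exists>!p. p \<in> deep_locus n \<and> (\<forall>e'\<in>edges n - {e}. p (cluster_var n e') = w e')"
proof -
  obtain m where m: "n = 2 * m + 2" "m \<ge> 1"
  proof
    show "n = 2 * (n div 2 - 1) + 2" "n div 2 - 1 \<ge> 1" using n by auto
  qed
  have n3: "n \<ge> 3" using n by simp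
  from missing_edge_value[OF m e w]
  obtain c where c': "c \<noteq> 0 \<and> (w(e := c)) (1, n) = path_ratio (w(e := c)) 1 m"
    and unique: "\<forall>d. d \<noteq> 0 \<and> (w(e := d)) (1, n) = path_ratio (w(e := d)) 1 m \<longrightarrow> d = c"
    by (rule ex1E)
  note c = conjunct1[OF c'] conjunct2[OF c']
  let ?w = "w(e := c)"
  have short: "(i, i + 1) \<in> edges n" if "1 \<le> i" "i < n" for i
    using that by (auto simp: edges_def segments_def)
  have edge_cases: "e' = (1, n) \<or> (\<exists>i. e' = (i, i + 1) \<and> 1 \<le> i \<and> i < n)" if "e' \<in> edges n" for e'
    using that by (auto simp: edges_def segments_def)
  have "\<exists>p\<in>deep_locus n. \<forall>i. 1 \<le> i \<and> i < n \<longrightarrow> p (cluster_var n (i, i + 1)) = ?w (i, i + 1)"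
  proof (rule deep_point_exists[OF n, of "\<lambda>i. ?w (i, i + 1)"])
    show "?w (i, i + 1) \<noteq> 0" if "1 \<le> i" "i < n" for i
      using c(1) w[of "(i, i + 1)"] short[OF that] by (cases "(i, i + 1) = e") auto
  qed blast
  then obtain p where p: "p \<in> deep_locus n"
    "\<And>i. \<lbrakk>1 \<le> i; i < n\<rbrakk> \<Longrightarrow> p (cluster_var n (i, i + 1)) = ?w (i, i + 1)"
    by blast
  have p_edges: "p (cluster_var n e') = ?w e'" if "e' \<in> edges n" for e'
    using edge_cases[OF that]
  proof (elim disjE exE conjE)
    assume "e' = (1, n)"
    then show ?thesis by (simp only: closing_edge_value[OF m p] c(2))
  next
    fix i assume "e' = (i, i + 1)" "1 \<le> i" "i < n"
    then show ?thesis by (simp only: p(2))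
  qed
  show ?thesis
  proof (rule ex1I[of _ p])
    show "p \<in> deep_locus n \<and> (\<forall>e'\<in>edges n - {e}. p (cluster_var n e') = w e')"
      using p(1) p_edges by auto
  next
    fix q assume q: "q \<in> deep_locus n \<and> (\<forall>e'\<in>edges n - {e}. q (cluster_var n e') = w e')"
    define d where "d = q (cluster_var n e)"
    have q_edges: "q (cluster_var n e') = (w(e := d)) e'" if "e' \<in> edges n" for e'
      using q that by (auto simp: d_def)
    have "d \<noteq> 0"
      unfolding d_def by (rule edge_value_nonzero[OF _ e]) (use q in \<open>simp add: deep_locus_iff\<close>)
    moreover have "(w(e := d)) (1, n) = path_ratio (w(e := d)) 1 m"
    proof -
      have "(1, n) \<in> edges n" using n by (auto simp: edges_def segments_def)
      moreover have "q (cluster_var n (1, n)) = path_ratio (w(e := d)) 1 m"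
        using q by (intro closing_edge_value m q_edges short) auto
      ultimately show ?thesis by (simp only: q_edges)
    qed
    ultimately have "d = c" by (intro unique[rule_format] conjI)
    then show "q = p"
      using q p(1) by (intro deep_point_eqI[OF n3]) (simp_all only: q_edges p_edges short)
  qed
qed

lemma deep_point_extending_edges:
  fixes w :: "nat \<times> nat \<Rightarrow> 'k::field"
  assumes n: "even n" "n \<ge> 4" and w: "\<And>e. e \<in> edges n \<Longrightarrow> w e \<noteq> 0"
  shows "(\<exists>p\<in>deep_locus n. extends n w p) \<longleftrightarrow> balanced n w"
proof -
  obtain m where m: "n = 2 * m + 2" "m \<ge> 1"
  proof
    show "n = 2 * (n div 2 - 1) + 2" "n div 2 - 1 \<ge> 1" using n by auto
  qed
  have short: "(i, i + 1) \<in> edges n" if "1 \<le> i" "i < n" for i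
    using that by (auto simp: edges_def segments_def)
  have long: "(1, n) \<in> edges n" using n by (auto simp: edges_def segments_def)
  have bal: "balanced n w \<longleftrightarrow> w (1, n) = path_ratio w 1 m"
    using w short long by (intro balanced_iff m(1)) auto
  show ?thesis
    unfolding bal
  proof
    assume "\<exists>p\<in>deep_locus n. extends n w p"
    then obtain p where "p \<in> deep_locus n" "\<And>e. e \<in> edges n \<Longrightarrow> p (cluster_var n e) = w e"
      by (auto simp: extends_def)
    then show "w (1, n) = path_ratio w 1 m"
      using closing_edge_value[OF m, of p w] short long by auto
  next
    assume eq: "w (1, n) = path_ratio w 1 m"
    obtain p where p: "p \<in> deep_locus n" "\<And>i. \<lbrakk>1 \<le> i; i < n\<rbrakk> \<Longrightarrow> p (cluster_var n (i, i + 1)) = w (i, i + 1)"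
      using deep_point_exists[OF n, of "\<lambda>i. w (i, i + 1)"] w short by metis
    have "extends n w p"
      unfolding extends_def
    proof
      fix e assume "e \<in> edges n"
      then have "e = (1, n) \<or> (\<exists>i. e = (i, i + 1) \<and> 1 \<le> i \<and> i < n)"
        by (auto simp: edges_def segments_def)
      then show "p (cluster_var n e) = w e"
        using closing_edge_value[OF m p] eq p(2) by auto
    qed
    then show "\<exists>p\<in>deep_locus n. extends n w p" using p(1) by blast
  qed
qed

definition boundary_coordinates :: "nat \<Rightarrow> (cluster_element \<Rightarrow> 'k::field) \<Rightarrow> nat \<Rightarrow> 'k" where
  "boundary_coordinates n p = (\<lambda>i\<in>{1..n - 1}. p (cluster_var n (i, i + 1)))"

lemma bij_betw_boundary_coordinates:
  assumes n: "even n" "n \<ge> 4"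
  shows "bij_betw (boundary_coordinates n) (deep_locus n :: (cluster_element \<Rightarrow> 'k::field) set) (torus (n - 1))"
  unfolding bij_betw_def
proof
  have coord: "boundary_coordinates n p i = p (cluster_var n (i, i + 1))" if "1 \<le> i" "i < n"
    for p :: "cluster_element \<Rightarrow> 'k" and i
    using that by (auto simp: boundary_coordinates_def)
  show "inj_on (boundary_coordinates n) (deep_locus n :: (cluster_element \<Rightarrow> 'k) set)"
  proof (rule inj_onI)
    fix p q :: "cluster_element \<Rightarrow> 'k"
    assume "p \<in> deep_locus n" "q \<in> deep_locus n" and eq: "boundary_coordinates n p = boundary_coordinates n q"
    then show "p = q"
      using n coord[of _ p] coord[of _ q] by (intro deep_point_eqI[of n]) auto
  qed
  show "boundary_coordinates n ` (deep_locus n :: (cluster_element \<Rightarrow> 'k) set) = torus (n - 1)"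
  proof (intro equalityI subsetI)
    fix t :: "nat \<Rightarrow> 'k" assume "t \<in> boundary_coordinates n ` deep_locus n"
    then obtain p where p: "p \<in> deep_locus n" "t = boundary_coordinates n p" by blast
    have "p (cluster_var n (i, i + 1)) \<noteq> 0" if "i \<in> {1..n - 1}" for i
      using that p(1) by (intro edge_value_nonzero) (auto simp: deep_locus_iff edges_def segments_def)
    then show "t \<in> torus (n - 1)"
      by (auto simp: torus_def p(2) boundary_coordinates_def)
  next
    fix t :: "nat \<Rightarrow> 'k" assume t: "t \<in> torus (n - 1)"
    have "t i \<noteq> 0" if "1 \<le> i" "i < n" for i
      using PiE_mem[OF t[unfolded torus_def], of i] that by simp
    then obtain p where p: "p \<in> deep_locus n" "\<And>i. \<lbrakk>1 \<le> i; i < n\<rbrakk> \<Longrightarrow> p (cluster_var n (i, i + 1)) = t i"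
      using deep_point_exists[OF n, of t] by metis
    have "boundary_coordinates n p = t"
    proof (rule PiE_ext)
      show "boundary_coordinates n p \<in> {1..n - 1} \<rightarrow>\<^sub>E UNIV" by (simp add: boundary_coordinates_def)
      show "t \<in> {1..n - 1} \<rightarrow>\<^sub>E UNIV" using t by (auto simp: torus_def PiE_iff)
      show "boundary_coordinates n p i = t i" if "i \<in> {1..n - 1}" for i
      proof -
        have "1 \<le> i" "i < n" using that n by auto
        then show ?thesis using that p(2) by (simp add: boundary_coordinates_def)
      qed
    qed
    with p(1) show "t \<in> boundary_coordinates n ` deep_locus n" by blast
  qed
qed

lemma algebra_generated_prod:
  assumes "\<And>x. x \<in> A \<Longrightarrow> f x \<in> algebra_generated F"
  shows "(\<lambda>p. \<Prod>x\<in>A. f x p) \<in> algebra_generated F"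
  using assms
proof (induction A rule: infinite_finite_induct)
  case (insert x A)
  then show ?case
    using algebra_generated.mult[of "f x" F "\<lambda>p. \<Prod>x\<in>A. f x p"] by simp
qed (simp_all add: algebra_generated.const)

lemma torus_functionsI:
  assumes "i \<in> {1..m}"
  shows "(\<lambda>t. t i) \<in> algebra_generated (torus_functions m)"
    and "(\<lambda>t. inverse (t i)) \<in> algebra_generated (torus_functions m)"
  using assms by (auto simp: torus_functions_def intro!: algebra_generated.gen)

text \<open>
  Inverses are needed for the edge \<open>x\<^sub>1\<^sub>n\<close>, which is not among the coordinates but is inverted
  in the cluster algebra.
\<close>

lemma path_ratio_torus:
  fixes l :: nat
  assumes "1 \<le> i" "i + 2 * m \<le> l"
  shows "(\<lambda>t :: nat \<Rightarrow> 'k::field. path_ratio (\<lambda>s. t (fst s)) i m) \<in> algebra_generated (torus_functions l)"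
    and "(\<lambda>t :: nat \<Rightarrow> 'k. inverse (path_ratio (\<lambda>s. t (fst s)) i m)) \<in> algebra_generated (torus_functions l)"
proof -
  let ?A = "algebra_generated (torus_functions l) :: ((nat \<Rightarrow> 'k) \<Rightarrow> 'k) set"
  have eq: "path_ratio (\<lambda>s. t (fst s)) i m =
      (- 1) ^ m * ((\<Prod>r = 0..m. t (i + 2 * r)) * (\<Prod>r = 1..m. inverse (t (i + 2 * r - 1))))" for t :: "nat \<Rightarrow> 'k"
    by (simp add: path_ratio_def divide_inverse flip: prod_inversef)
  have eq': "inverse (path_ratio (\<lambda>s. t (fst s)) i m) =
      (- 1) ^ m * ((\<Prod>r = 0..m. inverse (t (i + 2 * r))) * (\<Prod>r = 1..m. t (i + 2 * r - 1)))" for t :: "nat \<Rightarrow> 'k"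
    by (simp add: path_ratio_def divide_inverse power_inverse[symmetric] flip: prod_inversef)
  show "(\<lambda>t. path_ratio (\<lambda>s. t (fst s)) i m) \<in> ?A"
    unfolding eq using assms
    by (intro algebra_generated.mult algebra_generated.const algebra_generated_prod torus_functionsI) auto
  show "(\<lambda>t. inverse (path_ratio (\<lambda>s. t (fst s)) i m)) \<in> ?A"
    unfolding eq' using assms
    by (intro algebra_generated.mult algebra_generated.const algebra_generated_prod torus_functionsI) auto
qed

lemma cluster_function_on_torus:
  fixes a :: cluster_element
  assumes n: "even n" "n \<ge> 4" and a: "a \<in> carrier (cluster_algebra n)"
  shows "\<exists>g\<in>algebra_generated (torus_functions (n - 1)).
    \<forall>p\<in>(deep_locus n :: (cluster_element \<Rightarrow> 'k::field) set). p a = g (boundary_coordinates n p)"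
proof -
  let ?A = "algebra_generated (torus_functions (n - 1)) :: ((nat \<Rightarrow> 'k) \<Rightarrow> 'k) set"
  let ?V = "deep_locus n :: (cluster_element \<Rightarrow> 'k) set"
  let ?Q = "\<lambda>f. \<exists>g\<in>?A. \<forall>p\<in>?V. f p = g (boundary_coordinates n p)"
  have n3: "n \<ge> 3" using n by simp
  have val: "p (cluster_var n (i, j)) =
      (if i mod 2 \<noteq> j mod 2 then path_ratio (\<lambda>s. boundary_coordinates n p (fst s)) i ((j - i - 1) div 2) else 0)"
    if "p \<in> ?V" "(i, j) \<in> segments n" for p i j
    using that by (intro deep_point_value n3) (auto simp: boundary_coordinates_def)
  have len: "1 \<le> i" "i + 2 * ((j - i - 1) div 2) \<le> n - 1" if "(i, j) \<in> segments n" for i j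
    using that by (auto simp: segments_def)
  show ?thesis
  proof (rule cluster_evaluation_induct[where V = ?V and Q = ?Q, OF a])
    show "?V \<subseteq> cluster_variety n" by (auto simp: deep_locus_iff)
    show "?Q g" if "\<And>p. p \<in> ?V \<Longrightarrow> f p = g p" "?Q f" for f g
      using that by metis
    show "?Q (\<lambda>_. c)" for c
      by (rule bexI[OF _ algebra_generated.const[of c]]) simp
    show "?Q (\<lambda>p. f p + g p)" if fg: "?Q f" "?Q g" for f g
    proof -
      obtain f' g' where "f' \<in> ?A" "g' \<in> ?A" "\<forall>p\<in>?V. f p = f' (boundary_coordinates n p)"
        "\<forall>p\<in>?V. g p = g' (boundary_coordinates n p)"
        using fg by blast
      then show ?thesis
        by (intro bexI[OF _ algebra_generated.add[of f' _ g']]) simp_all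
    qed
    show "?Q (\<lambda>p. f p * g p)" if fg: "?Q f" "?Q g" for f g
    proof -
      obtain f' g' where "f' \<in> ?A" "g' \<in> ?A" "\<forall>p\<in>?V. f p = f' (boundary_coordinates n p)"
        "\<forall>p\<in>?V. g p = g' (boundary_coordinates n p)"
        using fg by blast
      then show ?thesis
        by (intro bexI[OF _ algebra_generated.mult[of f' _ g']]) simp_all
    qed
    show "?Q (\<lambda>p. p (cluster_var n s))" if "s \<in> segments n" for s
    proof (cases s)
      case (Pair i j)
      note ij = that[unfolded Pair]
      show ?thesis
      proof (cases "i mod 2 = j mod 2")
        case True
        have "p (cluster_var n (i, j)) = 0" if "p \<in> ?V" for p
          using val[OF that ij] True by simp
        then show ?thesis
          unfolding Pair by (intro bexI[OF _ algebra_generated.const[of 0]] ballI)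
      next
        case False
        have "p (cluster_var n (i, j)) =
            path_ratio (\<lambda>s. boundary_coordinates n p (fst s)) i ((j - i - 1) div 2)" if "p \<in> ?V" for p
          using val[OF that ij] False by simp
        then show ?thesis
          unfolding Pair by (intro bexI[OF _ path_ratio_torus(1)[OF len[OF ij]]] ballI)
      qed
    qed
    show "?Q (\<lambda>p. inverse (p (cluster_var n e)))" if e: "e \<in> edges n" for e
    proof (cases e)
      case (Pair i j)
      note ij = edge_imp_segment[OF e, unfolded Pair]
      have "i mod 2 \<noteq> j mod 2"
        using e n by (auto simp: Pair edges_def mod_2_eq_odd)
      then have "inverse (p (cluster_var n (i, j))) =
          inverse (path_ratio (\<lambda>s. boundary_coordinates n p (fst s)) i ((j - i - 1) div 2))" if "p \<in> ?V" for p
        using val[OF that ij] by simp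
      then show ?thesis
        unfolding Pair by (intro bexI[OF _ path_ratio_torus(2)[OF len[OF ij]]] ballI)
    qed
  qed
qed

text \<open>
  Regular functions are transported in both directions along the coordinates: the torus functions
  \<open>t\<^sub>i\<close> and \<open>1/t\<^sub>i\<close> come from the edges and their inverses, and elements of the cluster algebra become Laurent
  polynomials.
\<close>

lemma variety_iso_deep_locus_torus:
  assumes n: "even n" "n \<ge> 4"
  shows "variety_iso (deep_locus n :: (cluster_element \<Rightarrow> 'k::field) set) (cluster_functions n)
    (torus (n - 1)) (torus_functions (n - 1)) (boundary_coordinates n)"
proof -
  let ?V = "deep_locus n :: (cluster_element \<Rightarrow> 'k) set"
  let ?\<phi> = "boundary_coordinates n :: (cluster_element \<Rightarrow> 'k) \<Rightarrow> nat \<Rightarrow> 'k"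
  have bij: "bij_betw ?\<phi> ?V (torus (n - 1))"
    by (rule bij_betw_boundary_coordinates[OF n])
  have pull: "\<exists>g'\<in>algebra_generated (cluster_functions n). \<forall>p\<in>?V. g (?\<phi> p) = g' p"
    if "g \<in> algebra_generated (torus_functions (n - 1))" for g
    using that
  proof induction
    case (const c)
    show ?case by (rule bexI[OF _ algebra_generated.const[of c]]) simp
  next
    case (gen f)
    then consider i where "i \<in> {1..n - 1}" "f = (\<lambda>t. t i)"
      | i where "i \<in> {1..n - 1}" "f = (\<lambda>t. inverse (t i))"
      by (auto simp: torus_functions_def)
    then show ?case
    proof cases
      case (1 i)
      have "(\<lambda>p. p (cluster_var n (i, i + 1))) \<in> cluster_functions n"
        using 1(1) cluster_var_closed[of "(i, i + 1)" n] by (auto simp: cluster_functions_def segments_def)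
      then show ?thesis
        using 1 by (intro bexI[OF _ algebra_generated.gen]) (auto simp: boundary_coordinates_def)
    next
      case (2 i)
      then have "(i, i + 1) \<in> edges n" by (auto simp: edges_def segments_def)
      then obtain a where "a \<in> carrier (cluster_algebra n)"
        "\<And>p :: cluster_element \<Rightarrow> 'k. p \<in> cluster_variety n \<Longrightarrow> p a = inverse (p (cluster_var n (i, i + 1)))"
        using inverse_edge_value by blast
      then show ?thesis
        using 2 by (intro bexI[OF _ algebra_generated.gen[of "\<lambda>p. p a"]])
          (auto simp: boundary_coordinates_def deep_locus_iff cluster_functions_def)
    qed
  next
    case (add f g)
    then obtain f' g' where "f' \<in> algebra_generated (cluster_functions n)" "g' \<in> algebra_generated (cluster_functions n)"
      "\<forall>p\<in>?V. f (?\<phi> p) = f' p" "\<forall>p\<in>?V. g (?\<phi> p) = g' p"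
      by blast
    then show ?case by (intro bexI[OF _ algebra_generated.add[of f' _ g']]) simp_all
  next
    case (mult f g)
    then obtain f' g' where "f' \<in> algebra_generated (cluster_functions n)" "g' \<in> algebra_generated (cluster_functions n)"
      "\<forall>p\<in>?V. f (?\<phi> p) = f' p" "\<forall>p\<in>?V. g (?\<phi> p) = g' p"
      by blast
    then show ?case by (intro bexI[OF _ algebra_generated.mult[of f' _ g']]) simp_all
  qed
  have push: "\<exists>g'\<in>algebra_generated (torus_functions (n - 1)). \<forall>p\<in>?V. g p = g' (?\<phi> p)"
    if "g \<in> algebra_generated (cluster_functions n)" for g
    using that
  proof induction
    case (const c)
    show ?case by (rule bexI[OF _ algebra_generated.const[of c]]) simp
  next
    case (gen f)
    then show ?case
      using cluster_function_on_torus[OF n] by (auto simp: cluster_functions_def)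
  next
    case (add f g)
    then obtain f' g' where "f' \<in> algebra_generated (torus_functions (n - 1))" "g' \<in> algebra_generated (torus_functions (n - 1))"
      "\<forall>p\<in>?V. f p = f' (?\<phi> p)" "\<forall>p\<in>?V. g p = g' (?\<phi> p)"
      by blast
    then show ?case by (intro bexI[OF _ algebra_generated.add[of f' _ g']]) simp_all
  next
    case (mult f g)
    then obtain f' g' where "f' \<in> algebra_generated (torus_functions (n - 1))" "g' \<in> algebra_generated (torus_functions (n - 1))"
      "\<forall>p\<in>?V. f p = f' (?\<phi> p)" "\<forall>p\<in>?V. g p = g' (?\<phi> p)"
      by blast
    then show ?case by (intro bexI[OF _ algebra_generated.mult[of f' _ g']]) simp_all
  qed
  have onto: "(\<forall>t\<in>torus (n - 1). P t) \<longleftrightarrow> (\<forall>p\<in>?V. P (?\<phi> p))" for P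
    unfolding bij_betw_imp_surj_on[OF bij, symmetric] by simp
  have "regular_on (torus (n - 1)) (torus_functions (n - 1)) f \<longleftrightarrow>
      regular_on ?V (cluster_functions n) (\<lambda>p. f (?\<phi> p))" for f
    unfolding regular_on_def onto
  proof
    assume "\<exists>g\<in>algebra_generated (torus_functions (n - 1)). \<forall>p\<in>?V. f (?\<phi> p) = g (?\<phi> p)"
    then show "\<exists>g\<in>algebra_generated (cluster_functions n). \<forall>p\<in>?V. f (?\<phi> p) = g p"
      using pull by metis
  next
    assume "\<exists>g\<in>algebra_generated (cluster_functions n). \<forall>p\<in>?V. f (?\<phi> p) = g p"
    then show "\<exists>g\<in>algebra_generated (torus_functions (n - 1)). \<forall>p\<in>?V. f (?\<phi> p) = g (?\<phi> p)"
      using push by metis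
  qed
  with bij show ?thesis by (simp add: variety_iso_def)
qed

theorem theorem3p7:
  fixes n :: nat
  assumes "n \<ge> 3"
  shows
    "(odd n \<longrightarrow> (deep_locus n :: (cluster_element \<Rightarrow> 'k::field) set) = {}) \<and>
     (even n \<longrightarrow>
       (\<forall>w :: nat \<times> nat \<Rightarrow> 'k. (\<forall>e\<in>edges n. w e \<noteq> 0) \<longrightarrow>
          ((\<exists>p\<in>deep_locus n. extends n w p) \<longleftrightarrow>
             (\<Prod>t = 1..n div 2. w (2 * t - 1, 2 * t)) /
             (w (1, n) * (\<Prod>t = 1..<n div 2. w (2 * t, 2 * t + 1)))
               = (- 1) ^ ((n + 2) div 2)) \<and>
          (\<forall>p\<in>deep_locus n. \<forall>q\<in>deep_locus n. extends n w p \<and> extends n w q \<longrightarrow> p = q) \<and>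
          (\<forall>p\<in>deep_locus n. extends n w p \<longrightarrow>
             (\<forall>i j. (i, j) \<in> diagonals n \<longrightarrow>
                p (cluster_var n (i, j)) =
                  (if i mod 2 \<noteq> j mod 2
                   then (- 1) ^ ((j - i - 1) div 2) *
                     ((\<Prod>t = 0..(j - i - 1) div 2. w (i + 2 * t, i + 2 * t + 1)) /
                      (\<Prod>t = 1..(j - i - 1) div 2. w (i + 2 * t - 1, i + 2 * t)))
                   else 0)))) \<and>
       (\<forall>e\<in>edges n. \<forall>w :: nat \<times> nat \<Rightarrow> 'k. (\<forall>e'\<in>edges n - {e}. w e' \<noteq> 0) \<longrightarrow>
          (\<exists>!p. p \<in> deep_locus n \<and> (\<forall>e'\<in>edges n - {e}. p (cluster_var n e') = w e'))) \<and>
       (\<exists>\<phi>. variety_iso (deep_locus n :: (cluster_element \<Rightarrow> 'k) set) (cluster_functions n)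
              (torus (n - 1)) (torus_functions (n - 1)) \<phi>))"
proof (intro conjI impI allI ballI)
  assume "odd n"
  then show "(deep_locus n :: (cluster_element \<Rightarrow> 'k) set) = {}"
    using deep_vector_zero_iff(1)[OF assms] by (auto simp: deep_locus_iff)
next
  assume even: "even n"
  then have n: "n \<ge> 4" using assms by (cases "n = 3") auto
  {
    fix w :: "nat \<times> nat \<Rightarrow> 'k" assume w: "\<forall>e\<in>edges n. w e \<noteq> 0"
    show "(\<exists>p\<in>deep_locus n. extends n w p) \<longleftrightarrow>
             (\<Prod>t = 1..n div 2. w (2 * t - 1, 2 * t)) /
             (w (1, n) * (\<Prod>t = 1..<n div 2. w (2 * t, 2 * t + 1)))
               = (- 1) ^ ((n + 2) div 2)"
      using deep_point_extending_edges[OF even n, of w] w unfolding balanced_def by blast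
    show "p = q" if "p \<in> deep_locus n" "q \<in> deep_locus n" "extends n w p \<and> extends n w q" for p q
      using that by (intro deep_point_eqI[OF assms]) (auto simp: extends_def edges_def segments_def)
    show "p (cluster_var n (i, j)) =
        (if i mod 2 \<noteq> j mod 2
         then (- 1) ^ ((j - i - 1) div 2) *
           ((\<Prod>t = 0..(j - i - 1) div 2. w (i + 2 * t, i + 2 * t + 1)) /
            (\<Prod>t = 1..(j - i - 1) div 2. w (i + 2 * t - 1, i + 2 * t)))
         else 0)"
      if "p \<in> deep_locus n" "extends n w p" "(i, j) \<in> diagonals n" for p i j
      using deep_point_value[OF assms that(1), of i j w] that(2,3)
      by (simp add: path_ratio_def diagonals_def extends_def edges_def segments_def)
  }
  show "\<exists>!p. p \<in> deep_locus n \<and> (\<forall>e'\<in>edges n - {e}. p (cluster_var n e') = w e')"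
    if "e \<in> edges n" "\<forall>e'\<in>edges n - {e}. w e' \<noteq> 0" for e and w :: "nat \<times> nat \<Rightarrow> 'k"
    using that by (intro deep_point_missing_edge even n) auto
  show "\<exists>\<phi>. variety_iso (deep_locus n :: (cluster_element \<Rightarrow> 'k) set) (cluster_functions n)
              (torus (n - 1)) (torus_functions (n - 1)) \<phi>"
    using variety_iso_deep_locus_torus[OF even n] by blast
qed

end
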